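(* Let $k\ge 3$ be an integer. Let $H$ be any graph obtained from two vertex-disjoint complete graphs $K_{k-2}$ and $K_2$ by joining the vertices of $K_{k-2}$ to the vertices of $K_2$ by an arbitrary set of edges (so $V(H)=V(K_{k-2})\cup V(K_2)$, and the edges of $H$ are those of $K_{k-2}$ and $K_2$ together with an arbitrary set of edges between $V(K_{k-2})$ and $V(K_2)$). Assume that $H$ is not a copy of $K_k$. Then $H$ is $k$-Tur\'an-good.
   Context: All graphs are finite and simple. $K_r$ is the complete graph on $r$ vertices. $\mathcal{N}(H,G)$ denotes the number of copies of $H$ in $G$, i.e. the number of (not necessarily induced) subgraphs of $G$ isomorphic to $H$. A graph is $F$-free if it contains no copy of $F$ as a (not necessarily induced) subgraph. $ex(n,H,F)=\max\{\mathcal{N}(H,G): G \text{ is an } n\text{-vertex } F\text{-free graph}\}$. The Tur\'an graph $T_{k-1}(n)$ is the complete $(k-1)$-partite graph on $n$ vertices in which each class has size $\lceil n/(k-1)\rceil$ or $\lfloor n/(k-1)\rfloor$. A graph $H$ that does not contain $K_k$ as a subgraph is called $k$-Tur\'an-good if $ex(n,H,K_k)=\mathcal{N}(H,T_{k-1}(n))$ for every sufficiently large $n$. *)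

theory Defs
  imports "HOL-Library.Ramsey"
begin

datatype 'a ugraph = Graph (verts: "'a set") (edges: "'a set set")

definition simple_graph :: "'a ugraph \<Rightarrow> bool" where
  "simple_graph G \<longleftrightarrow> finite (verts G) \<and> edges G \<subseteq> [verts G]\<^bsup>2\<^esup>"

definition subgraph :: "'a ugraph \<Rightarrow> 'a ugraph \<Rightarrow> bool" where
  "subgraph S G \<longleftrightarrow> simple_graph S \<and> verts S \<subseteq> verts G \<and> edges S \<subseteq> edges G"

definition graph_iso :: "'a ugraph \<Rightarrow> 'b ugraph \<Rightarrow> bool" where
  "graph_iso G H \<longleftrightarrow>
     (\<exists>f. bij_betw f (verts G) (verts H) \<and> (\<lambda>e. f ` e) ` edges G = edges H)"

definition copies :: "'b ugraph \<Rightarrow> 'a ugraph \<Rightarrow> 'a ugraph set" where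
  "copies H G = {S. subgraph S G \<and> graph_iso S H}"

definition num_copies :: "'b ugraph \<Rightarrow> 'a ugraph \<Rightarrow> nat" where
  "num_copies H G = card (copies H G)"

definition graph_free :: "'b ugraph \<Rightarrow> 'a ugraph \<Rightarrow> bool" where
  "graph_free F G \<longleftrightarrow> copies F G = {}"

definition complete_graph :: "nat \<Rightarrow> nat ugraph" where
  "complete_graph r = Graph {..<r} ([{..<r}]\<^bsup>2\<^esup>)"

(* Every finite graph is isomorphic to one with natural numbers as vertices,
   so the host graphs are taken over nat. *)
definition gen_turan_values :: "nat \<Rightarrow> 'b ugraph \<Rightarrow> 'c ugraph \<Rightarrow> nat set" where
  "gen_turan_values n H F =
     {num_copies H G | G :: nat ugraph. simple_graph G \<and> card (verts G) = n \<and> graph_free F G}"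

(* Max is meaningful here: the set is finite by finite_gen_turan_values below,
   and nonempty whenever some n-vertex graph is F-free. *)
definition gen_turan :: "nat \<Rightarrow> 'b ugraph \<Rightarrow> 'c ugraph \<Rightarrow> nat" where
  "gen_turan n H F = Max (gen_turan_values n H F)"

(* The r classes are the residue classes modulo r on {..<n}; their sizes are
   computed in card_turan_class below. *)
definition turan_graph :: "nat \<Rightarrow> nat \<Rightarrow> nat ugraph" where
  "turan_graph r n = Graph {..<n} {{u, v} | u v. u < n \<and> v < n \<and> u mod r \<noteq> v mod r}"

definition turan_good :: "nat \<Rightarrow> 'b ugraph \<Rightarrow> bool" where
  "turan_good k H \<longleftrightarrow>
     graph_free (complete_graph k) H \<and>
     (\<forall>\<^sub>F n in sequentially.
        gen_turan n H (complete_graph k) = num_copies H (turan_graph (k - 1) n))"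

lemma finite_gen_turan_values: "finite (gen_turan_values n H F)"
proof -
  have "num_copies H G \<le> 2 ^ n * 2 ^ (2 ^ n)"
    if "simple_graph G" "card (verts G) = n" for G :: "nat ugraph"
  proof -
    let ?V = "verts G"
    let ?P = "Pow ?V \<times> Pow (Pow ?V)"
    have fin: "finite ?V" using that by (simp add: simple_graph_def)
    have "copies H G \<subseteq> (\<lambda>(V, E). Graph V E) ` ?P"
    proof
      fix S assume "S \<in> copies H G"
      then have "verts S \<subseteq> ?V" "edges S \<subseteq> Pow ?V"
        by (auto simp: copies_def subgraph_def simple_graph_def nsets_def)
      then show "S \<in> (\<lambda>(V, E). Graph V E) ` ?P"
        by (intro image_eqI[of _ _ "(verts S, edges S)"]) auto
    qed
    then have "card (copies H G) \<le> card ?P"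
      using fin by (meson card_image_le card_mono finite_Pow_iff finite_SigmaI finite_imageI le_trans)
    also have "\<dots> = 2 ^ n * 2 ^ (2 ^ n)"
      using fin that by (simp add: card_cartesian_product card_Pow)
    finally show ?thesis by (simp add: num_copies_def)
  qed
  then have "gen_turan_values n H F \<subseteq> {..2 ^ n * 2 ^ (2 ^ n)}"
    by (auto simp: gen_turan_values_def)
  then show ?thesis using finite_subset by blast
qed

lemma card_turan_class:
  assumes "i < r"
  shows "card {v \<in> {..<n}. v mod r = i} = n div r + (if i < n mod r then 1 else 0)"
proof (induction n)
  case 0
  then show ?case by simp
next
  case (Suc n)
  have "{v \<in> {..<Suc n}. v mod r = i} =
      (if n mod r = i then insert n {v \<in> {..<n}. v mod r = i} else {v \<in> {..<n}. v mod r = i})"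
    by (auto simp: less_Suc_eq)
  moreover have "n mod r < r" using assms by simp
  ultimately show ?case using Suc assms
    by (auto simp: mod_Suc div_Suc split: if_splits)
qed

end

theory Submission imports Defs
begin

text \<open>
  Put \<open>r = k - 1\<close> and \<open>s = k - 2\<close>. Counting copies of \<open>H\<close> amounts to counting embeddings, and an embedding
  sends the two parts of \<open>H\<close> to a disjoint pair \<open>(Q, e)\<close> of an \<open>s\<close>-clique and an edge. In a \<open>K\<^sub>k\<close>-free graph
  some edge between \<open>Q\<close> and \<open>e\<close> is missing, so the pair carries at most \<open>w\<^sub>1\<close> embeddings, and at most
  \<open>w\<^sub>2 \<le> w\<^sub>1\<close> if two disjoint edges are missing; in the Turan graph the missing edges are exactly one
  edge or exactly two disjoint edges, so equality holds for every pair. It remains to bound the number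
  of all pairs and the number of pairs without a missing 2-matching. The latter is bounded by counting
  \<open>r\<close>-cliques together with an outside vertex, which misses at least one vertex of the clique. For the former,
  let \<open>\<epsilon>\<close> be the number of edges by which the graph falls short of the Turan graph. Zykov's theorem gives
  a loss of \<open>\<epsilon>\<close> times the number of \<open>s\<close>-cliques of the Turan graph in the main term, which is of order \<open>\<epsilon> n\<^sup>s\<close>,
  while all remaining terms differ from those of the Turan graph by only \<open>O(\<epsilon> n\<^bsup>s-1\<^esup>)\<close>. The latter
  estimates are proved by induction, adding edges until there is an \<open>r\<close>-clique and then removing that clique.
\<close>

section \<open>Cliques and Zykov's theorem\<close>

text \<open>Let P be the number of all pairs and S the number of pairs without a missing 2-matching.
  The bound on embeddings is w2 (P - S) + w1 S = w2 P + (w1 - w2) S, which increases in P and in S,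
  so the two can be maximised separately. For S the Turan graph is optimal for every n; the argument
  for P needs n large. The obstacle lies in P. It is the product of the numbers of s-cliques and of
  edges, minus the edges that meet the s-clique. There the numbers of s-cliques and (s+1)-cliques
  enter negatively, and an outside vertex that misses several vertices of the clique makes the
  subtracted term smaller. Zykov's upper bounds alone therefore do not decide: lower bounds on
  clique counts and an upper bound on irregular vertices are needed, all in terms of the same
  \<epsilon>. The induction supplies them because \<epsilon> acts as a budget: adding an edge lowers
  it by one, and removing an r-clique lowers it by at least the number of outside vertices with
  fewer than r - 1 neighbours in that clique.\<close>

definition clq :: "('a \<Rightarrow> 'a \<Rightarrow> bool) \<Rightarrow> 'a set \<Rightarrow> nat \<Rightarrow> 'a set set" where
  "clq R V j = {Q \<in> [V]\<^bsup>j\<^esup>. pairwise R Q}"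

lemma clq_iff: "Q \<in> clq R V j \<longleftrightarrow> Q \<subseteq> V \<and> finite Q \<and> card Q = j \<and> pairwise R Q"
  by (auto simp: clq_def nsets_def)

lemma clqI: "finite V \<Longrightarrow> Q \<subseteq> V \<Longrightarrow> card Q = j \<Longrightarrow> pairwise R Q \<Longrightarrow> Q \<in> clq R V j"
  using finite_subset[of Q V] by (simp add: clq_iff)

lemma finite_clq [simp]: "finite V \<Longrightarrow> finite (clq R V j)"
  by (simp add: clq_def finite_imp_finite_nsets)

lemma clq_mono: "V \<subseteq> W \<Longrightarrow> (\<And>x y. x \<in> V \<Longrightarrow> y \<in> V \<Longrightarrow> R x y \<Longrightarrow> R' x y) \<Longrightarrow> clq R V j \<subseteq> clq R' W j"
  by (simp add: clq_iff pairwise_def subset_iff)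

lemma clq_0 [simp]: "clq R V 0 = {{}}"
  by (auto simp: clq_iff)

lemma clq_1: "clq R V (Suc 0) = (\<lambda>x. {x}) ` V"
  by (auto simp: clq_iff card_Suc_eq)

lemma card_clq_1: "card (clq R V (Suc 0)) = card V"
  by (simp add: clq_1 card_image)

lemma pair_in_clq_2:
  "symp R \<Longrightarrow> {x, y} \<in> clq R V 2 \<longleftrightarrow> x \<in> V \<and> y \<in> V \<and> x \<noteq> y \<and> R x y"
  by (auto simp: clq_iff card_insert_if pairwise_insert symp_def)

lemma clq_insert:
  "Q \<in> clq R V j \<Longrightarrow> symp R \<Longrightarrow> x \<in> V \<Longrightarrow> x \<notin> Q \<Longrightarrow> (\<And>q. q \<in> Q \<Longrightarrow> R x q) \<Longrightarrow> insert x Q \<in> clq R V (Suc j)"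
  by (auto simp: clq_iff pairwise_insert symp_def)

lemma card_nsets_superset_le:
  assumes "finite V" "finite X"
  shows "card {Q \<in> [V]\<^bsup>j\<^esup>. X \<subseteq> Q} \<le> card V ^ (j - card X)"
proof (cases "card X \<le> j")
  case True
  have "inj_on (\<lambda>Q. Q - X) {Q \<in> [V]\<^bsup>j\<^esup>. X \<subseteq> Q}"
    by (auto simp: inj_on_def)
  moreover have "(\<lambda>Q. Q - X) ` {Q \<in> [V]\<^bsup>j\<^esup>. X \<subseteq> Q} \<subseteq> [V]\<^bsup>(j - card X)\<^esup>"
    using assms by (auto simp: nsets_def card_Diff_subset)
  ultimately have "card {Q \<in> [V]\<^bsup>j\<^esup>. X \<subseteq> Q} \<le> card ([V]\<^bsup>(j - card X)\<^esup>)"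
    using assms(1) by (intro card_inj_on_le finite_imp_finite_nsets)
  also have "\<dots> \<le> card V ^ (j - card X)"
    using assms by (cases "j - card X \<le> card V") (auto simp: binomial_le_pow binomial_eq_0)
  finally show ?thesis .
next
  case False
  then have "{Q \<in> [V]\<^bsup>j\<^esup>. X \<subseteq> Q} = {}"
    by (auto simp: nsets_def dest: card_mono)
  then show ?thesis by (simp only: card.empty)
qed

text \<open>If there is no \<open>r\<close>-clique, adding any edge cannot create an \<open>(r + 1)\<close>-clique.\<close>

lemma clique_free_induct [consumes 5, case_names complete edge clique]:
  fixes R :: "'a \<Rightarrow> 'a \<Rightarrow> bool"
  assumes "finite V" "symp R" "irreflp R" "clq R V (Suc r) = {}" "r > 0"
    and complete: "\<And>V R. \<lbrakk>finite V; symp R; irreflp R; card V < r; pairwise R V\<rbrakk> \<Longrightarrow> P R V"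
    and edge: "\<And>V R u v. \<lbrakk>finite V; symp R; irreflp R; clq R V (Suc r) = {}; u \<in> V; v \<in> V; u \<noteq> v; \<not> R u v;
      symp (\<lambda>x y. R x y \<or> {x, y} = {u, v}); irreflp (\<lambda>x y. R x y \<or> {x, y} = {u, v});
      clq (\<lambda>x y. R x y \<or> {x, y} = {u, v}) V (Suc r) = {}; P (\<lambda>x y. R x y \<or> {x, y} = {u, v}) V\<rbrakk> \<Longrightarrow> P R V"
    and clique: "\<And>V R K. \<lbrakk>finite V; symp R; irreflp R; clq R V (Suc r) = {}; K \<in> clq R V r;
      clq R (V - K) (Suc r) = {}; P R (V - K)\<rbrakk> \<Longrightarrow> P R V"
  shows "P R V"
  using assms(1-4)
\<comment> \<open>Removing a nonempty clique lowers the first summand without raising the second;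
  adding an edge keeps the first and lowers the second.\<close>
proof (induction "card V + card {(x, y) \<in> V \<times> V. \<not> R x y}" arbitrary: V R rule: less_induct)
  case less
  note prems = less.prems
  show ?case
  proof (cases "clq R V r = {}")
    case False
    then obtain K where K: "K \<in> clq R V r" by blast
    have free: "clq R (V - K) (Suc r) = {}"
      using clq_mono[of "V - K" V R R "Suc r"] prems by auto
    have "K \<subseteq> V" "K \<noteq> {}" using K \<open>r > 0\<close> by (auto simp: clq_iff)
    then have "V - K \<subset> V" by blast
    then have "card (V - K) < card V" using prems(1) psubset_card_mono by blast
    moreover have "card {(x, y) \<in> (V - K) \<times> (V - K). \<not> R x y} \<le> card {(x, y) \<in> V \<times> V. \<not> R x y}"
      by (rule card_mono[OF finite_subset[of _ "V \<times> V"]]) (use prems(1) in auto)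
    ultimately have "P R (V - K)"
      using less.hyps[of "V - K" R] prems free by auto
    then show ?thesis using clique prems K free by blast
  next
    case noK: True
    show ?thesis
    proof (cases "pairwise R V")
      case True
      have "card V < r"
      proof (rule ccontr)
        assume "\<not> card V < r"
        then obtain K where "K \<subseteq> V" "card K = r" using obtain_subset_with_card_n[of r V] by auto
        then have "K \<in> clq R V r" using True prems(1) by (auto intro: clqI pairwise_subset)
        then show False using noK by simp
      qed
      then show ?thesis using complete prems True by blast
    next
      case False
      then obtain u v where uv: "u \<in> V" "v \<in> V" "u \<noteq> v" "\<not> R u v"
        by (auto simp: pairwise_def)
      let ?R = "\<lambda>x y. R x y \<or> {x, y} = {u, v}"
      have sym: "symp ?R" using prems(2) by (auto simp: symp_def doubleton_eq_iff)
      have irr: "irreflp ?R" using prems(3) uv by (auto simp: irreflp_def)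
      have free: "clq ?R V (Suc r) = {}"
      proof (rule ccontr)
        assume "clq ?R V (Suc r) \<noteq> {}"
        then obtain Q where Q: "Q \<in> clq ?R V (Suc r)" by blast
        \<comment> \<open>If the clique avoids u, it does not contain the new edge and any q will
          do; otherwise deleting u removes the only new edge. Either way r vertices remain that are
          pairwise adjacent in the old relation.\<close>
        obtain q where q: "q \<in> Q" "u \<in> Q \<Longrightarrow> q = u"
          using Q by (cases "u \<in> Q") (force simp: clq_iff)+
        have "Q - {q} \<in> clq R V r"
          using Q q by (auto simp: clq_iff pairwise_def doubleton_eq_iff)
        then show False using noK by simp
      qed
      have "{(x, y) \<in> V \<times> V. \<not> ?R x y} \<subset> {(x, y) \<in> V \<times> V. \<not> R x y}"
        using uv by auto
      then have "card {(x, y) \<in> V \<times> V. \<not> ?R x y} < card {(x, y) \<in> V \<times> V. \<not> R x y}"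
        by (rule psubset_card_mono[OF finite_subset[of _ "V \<times> V"], rotated 2]) (use prems(1) in auto)
      then have "P ?R V"
        using less.hyps[of V ?R] prems(1) sym irr free by simp
      then show ?thesis using edge prems uv sym irr free by blast
    qed
  qed
qed

text \<open>A j-clique is its part Q outside K together with j - |Q| common neighbours of Q in K;
  since K is complete, every such choice is allowed. Applied to an arbitrary graph and to the Turan
  graph, this reduces their comparison to the sizes of common neighbourhoods in K.\<close>

lemma card_clq_split:
  assumes "finite V" "symp R" "K \<subseteq> V" "pairwise R K"
  shows "card (clq R V j) = (\<Sum>i\<le>j. \<Sum>Q\<in>clq R (V - K) i. card {x\<in>K. \<forall>q\<in>Q. R x q} choose (j - i))"
proof -
  let ?N = "\<lambda>Q. {x\<in>K. \<forall>q\<in>Q. R x q}"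
  let ?S = "SIGMA i:{..j}. SIGMA Q:clq R (V - K) i. [?N Q]\<^bsup>(j - i)\<^esup>"
  have finK: "finite K" using assms finite_subset by blast
  have disj: "Q \<inter> Z = {}" if "Q \<in> clq R (V - K) i" "Z \<in> [?N Q]\<^bsup>m\<^esup>" for Q Z i m
    using that by (auto simp: clq_iff nsets_def)
  have "bij_betw (\<lambda>(i, Q, Z). Q \<union> Z) ?S (clq R V j)"
  proof (rule bij_betw_byWitness[where f' = "\<lambda>Q. (card (Q - K), Q - K, Q \<inter> K)"])
    show "\<forall>a\<in>?S. (\<lambda>Q. (card (Q - K), Q - K, Q \<inter> K)) ((\<lambda>(i, Q, Z). Q \<union> Z) a) = a"
    proof
      fix a assume "a \<in> ?S"
      then obtain i Q Z where a: "a = (i, Q, Z)" "Q \<in> clq R (V - K) i" "Z \<in> [?N Q]\<^bsup>(j - i)\<^esup>"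
        by blast
      then have "(Q \<union> Z) - K = Q" "(Q \<union> Z) \<inter> K = Z" "card Q = i"
        by (auto simp: clq_iff nsets_def)
      then show "(\<lambda>Q. (card (Q - K), Q - K, Q \<inter> K)) ((\<lambda>(i, Q, Z). Q \<union> Z) a) = a"
        using a(1) by simp
    qed
    show "\<forall>a'\<in>clq R V j. (\<lambda>(i, Q, Z). Q \<union> Z) (card (a' - K), a' - K, a' \<inter> K) = a'"
      by auto
    show "(\<lambda>(i, Q, Z). Q \<union> Z) ` ?S \<subseteq> clq R V j"
    proof
      fix X assume "X \<in> (\<lambda>(i, Q, Z). Q \<union> Z) ` ?S"
      then obtain i Q Z where X: "X = Q \<union> Z"
        and *: "i \<le> j" "Q \<in> clq R (V - K) i" "Z \<in> [?N Q]\<^bsup>(j - i)\<^esup>" by auto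
      then have "card (Q \<union> Z) = j"
        using disj[OF *(2,3)] by (auto simp: clq_iff nsets_def card_Un_disjoint)
      moreover have "pairwise R (Q \<union> Z)"
        using * assms(4) by (auto simp: clq_iff nsets_def pairwise_def subset_iff intro: sympD[OF assms(2)])
      ultimately show "X \<in> clq R V j" unfolding X
        using * assms(3) by (auto simp: clq_iff nsets_def)
    qed
    show "(\<lambda>Q. (card (Q - K), Q - K, Q \<inter> K)) ` clq R V j \<subseteq> ?S"
    proof (rule image_subsetI)
      fix Q assume Q: "Q \<in> clq R V j"
      then have c: "card (Q - K) + card (Q \<inter> K) = j"
        by (metis Int_Diff_Un Int_Diff_disjoint add.commute card_Un_disjoint clq_iff finite_Diff finite_Int)
      then have "card (Q - K) \<in> {..j}" by simp
      moreover have "Q - K \<in> clq R (V - K) (card (Q - K))"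
        using Q by (auto simp: clq_iff pairwise_def)
      moreover have "Q \<inter> K \<in> [?N (Q - K)]\<^bsup>(j - card (Q - K))\<^esup>"
        using Q c by (auto simp: clq_iff nsets_def pairwise_def)
      ultimately show "(card (Q - K), Q - K, Q \<inter> K) \<in> ?S" by blast
    qed
  qed
  then have "card (clq R V j) = card ?S" by (simp add: bij_betw_same_card)
  also have "\<dots> = (\<Sum>i\<le>j. \<Sum>Q\<in>clq R (V - K) i. card ([?N Q]\<^bsup>(j - i)\<^esup>))"
    using assms(1) finK
    by (subst card_SigmaI; (intro ballI finite_SigmaI)?; (intro sum.cong refl card_SigmaI)?;
      simp add: finite_imp_finite_nsets)
  finally show ?thesis by simp
qed

lemma card_edges_split:
  assumes "finite V" "symp R" "Q \<in> clq R V s"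
  shows "card (clq R V 2) = (s choose 2) + (\<Sum>v\<in>V - Q. card {x\<in>Q. R x v}) + card (clq R (V - Q) 2)"
proof -
  have Q: "Q \<subseteq> V" "card Q = s" "pairwise R Q" using assms by (auto simp: clq_iff)
  have "card (clq R V 2) = (\<Sum>i\<le>2. \<Sum>P\<in>clq R (V - Q) i. card {x\<in>Q. \<forall>q\<in>P. R x q} choose (2 - i))"
    by (rule card_clq_split[OF assms(1,2) Q(1,3)])
  also have "\<dots> = (s choose 2) + (\<Sum>v\<in>V - Q. card {x\<in>Q. R x v}) + card (clq R (V - Q) 2)"
    using Q by (simp add: numeral_2_eq_2 clq_1 sum.reindex)
  finally show ?thesis .
qed

text \<open>The common neighbours in K form a clique together with Q, so r - i + 1 of them would
  produce an (r+1)-clique.\<close>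

lemma card_common_neighbours_le:
  assumes "finite V" "symp R" "clq R V (Suc r) = {}" "K \<in> clq R V r" "Q \<in> clq R (V - K) i"
  shows "card {x\<in>K. \<forall>q\<in>Q. R x q} \<le> r - i"
proof (rule ccontr)
  let ?Z = "{x\<in>K. \<forall>q\<in>Q. R x q}"
  assume "\<not> card ?Z \<le> r - i"
  then have "Suc r - i \<le> card ?Z" by simp
  from obtain_subset_with_card_n[OF this]
  obtain Z where Z: "Z \<subseteq> ?Z" "card Z = Suc r - i" by metis
  have "finite K" "K \<subseteq> V" "pairwise R K" using assms by (auto simp: clq_iff)
  have fin: "finite Q" "finite Z" "card Q = i" "Q \<inter> K = {}" "pairwise R Q" "Q \<subseteq> V"
    using assms(5) Z \<open>finite K\<close> finite_subset[of Z K] by (auto simp: clq_iff)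
  have "Q \<inter> Z = {}" using fin Z by auto
  \<comment> \<open>Only an inequality: for i > r + 1 the difference \<open>Suc r - i\<close>
    truncates to 0 and Q alone is already too large. Hence the passage to a subset \<open>Y\<close>
    below.\<close>
  then have c: "card (Q \<union> Z) \<ge> Suc r" using fin Z by (simp add: card_Un_disjoint)
  have "pairwise R (Q \<union> Z)"
    using fin(5) Z(1) \<open>pairwise R K\<close> assms(2) unfolding pairwise_def symp_def subset_iff by simp blast
  moreover from obtain_subset_with_card_n[OF c]
  obtain Y where "Y \<subseteq> Q \<union> Z" "card Y = Suc r" by metis
  moreover have "Q \<union> Z \<subseteq> V" using fin Z \<open>K \<subseteq> V\<close> by auto
  ultimately have "Y \<in> clq R V (Suc r)"
    using assms(1) by (intro clqI) (auto intro: pairwise_subset)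
  then show False using assms(3) by simp
qed

abbreviation turan_adj :: "nat \<Rightarrow> nat \<Rightarrow> nat \<Rightarrow> bool" where
  "turan_adj r u v \<equiv> u mod r \<noteq> v mod r"

text \<open>The relation \<open>turan_adj\<close> lives on all naturals and ignores n; n enters only
  through the vertex set. Deleting the last r vertices thus leaves literally the graph for n -
  r.\<close>

definition turan_cliques :: "nat \<Rightarrow> nat \<Rightarrow> nat \<Rightarrow> nat" where
  "turan_cliques r j n = card (clq (turan_adj r) {..<n} j)"

lemma symp_turan: "symp (turan_adj r)" and irreflp_turan: "irreflp (turan_adj r)"
  by (auto simp: symp_def irreflp_def)

lemma turan_clique_inj: "Q \<in> clq (turan_adj r) V j \<Longrightarrow> inj_on (\<lambda>x. x mod r) Q"
  unfolding clq_iff pairwise_def inj_on_def by blast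

lemma turan_clique_free:
  assumes "r > 0"
  shows "clq (turan_adj r) V (Suc r) = {}"
proof (rule ccontr)
  assume "clq (turan_adj r) V (Suc r) \<noteq> {}"
  then obtain Q where Q: "Q \<in> clq (turan_adj r) V (Suc r)" by blast
  have "card Q \<le> card {..<r}"
    using turan_clique_inj[OF Q] assms by (intro card_inj_on_le[of "\<lambda>x. x mod r"]) auto
  then show False using Q by (simp add: clq_iff)
qed

lemma inj_on_mod_interval: "inj_on (\<lambda>x. x mod r) {n - r..<n::nat}"
proof (rule inj_onI)
  fix x y :: nat assume *: "x \<in> {n - r..<n}" "y \<in> {n - r..<n}" "x mod r = y mod r"
  show "x = y"
  proof (rule ccontr)
    assume "x \<noteq> y"
    then consider "x < y" | "y < x" by linarith
    then show False
    proof cases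
      case 1
      then have "r dvd y - x" using * mod_eq_dvd_iff_nat[of x y r] by auto
      then show False using 1 * by (auto dest: dvd_imp_le)
    next
      case 2
      then have "r dvd x - y" using * mod_eq_dvd_iff_nat[of y x r] by auto
      then show False using 2 * by (auto dest: dvd_imp_le)
    qed
  qed
qed

lemma last_turan_clique:
  assumes "r \<le> n"
  shows "{n - r..<n} \<in> clq (turan_adj r) {..<n} r"
proof -
  have "{n - r..<n} \<subseteq> {..<n}" "finite {n - r..<n}" "card {n - r..<n} = r" using assms by auto
  moreover have "pairwise (turan_adj r) {n - r..<n}"
    using inj_on_mod_interval[of r n] unfolding pairwise_def inj_on_def by blast
  ultimately show ?thesis by (simp add: clq_iff)
qed

text \<open>K meets every residue class once and Q occupies i of the classes, so exactly the
  vertices of K in the other classes are adjacent to all of Q. The bound of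
  \<open>card_common_neighbours_le\<close> is attained for every Q.\<close>

lemma card_turan_common_neighbours:
  assumes "r > 0" "K \<in> clq (turan_adj r) V r" "Q \<in> clq (turan_adj r) W i"
  shows "card {x\<in>K. \<forall>q\<in>Q. turan_adj r x q} = r - i"
proof -
  let ?m = "\<lambda>x. x mod r"
  have inj: "inj_on ?m K" "inj_on ?m Q" using turan_clique_inj assms by blast+
  have fin: "finite K" "card K = r" "finite Q" "card Q = i" using assms by (auto simp: clq_iff)
  have imK: "?m ` K = {..<r}"
    using inj fin assms(1) by (intro card_subset_eq) (auto simp: card_image)
  have "?m ` {x\<in>K. \<forall>q\<in>Q. turan_adj r x q} = {..<r} - ?m ` Q"
    using imK by (auto simp: image_iff) (metis imageE lessThan_iff)
  moreover have "inj_on ?m {x\<in>K. \<forall>q\<in>Q. turan_adj r x q}"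
    by (rule inj_on_subset[OF inj(1)]) auto
  ultimately have "card {x\<in>K. \<forall>q\<in>Q. turan_adj r x q} = card ({..<r} - ?m ` Q)"
    using card_image by fastforce
  also have "\<dots> = r - i"
    using inj fin assms(1) by (subst card_Diff_subset) (auto simp: card_image)
  finally show ?thesis .
qed

lemma turan_cliques_rec:
  assumes "r > 0" "r \<le> n"
  shows "turan_cliques r j n = (\<Sum>i\<le>j. turan_cliques r i (n - r) * ((r - i) choose (j - i)))"
proof -
  let ?K = "{n - r..<n}"
  have K: "?K \<in> clq (turan_adj r) {..<n} r" using last_turan_clique assms by blast
  have V: "{..<n} - ?K = {..<n - r}" by auto
  have "turan_cliques r j n = (\<Sum>i\<le>j. \<Sum>Q\<in>clq (turan_adj r) ({..<n} - ?K) i.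
      card {x\<in>?K. \<forall>q\<in>Q. turan_adj r x q} choose (j - i))"
    unfolding turan_cliques_def
    by (rule card_clq_split) (use K symp_turan in \<open>auto simp: clq_iff\<close>)
  also have "\<dots> = (\<Sum>i\<le>j. \<Sum>Q\<in>clq (turan_adj r) {..<n - r} i. (r - i) choose (j - i))"
    unfolding V
    by (intro sum.cong refl arg_cong2[of _ _ _ _ "(choose)"] card_turan_common_neighbours[OF assms(1) K])
  finally show ?thesis by (simp add: turan_cliques_def)
qed

lemma card_clq_complete:
  assumes "finite V" "pairwise R V"
  shows "card (clq R V j) = card V choose j"
proof -
  have "clq R V j = [V]\<^bsup>j\<^esup>"
    using assms by (auto simp: clq_def nsets_def intro: pairwise_subset)
  then show ?thesis by simp
qed

lemma turan_cliques_small: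
  assumes "n \<le> r"
  shows "turan_cliques r j n = n choose j"
proof -
  have "pairwise (turan_adj r) {..<n}" using assms by (auto simp: pairwise_def)
  then show ?thesis unfolding turan_cliques_def by (subst card_clq_complete) auto
qed

text \<open>Removing an r-clique gives the recursion of \<open>turan_cliques_rec\<close>, with r - i
  as an upper bound instead of an equality. A complete graph on fewer than r vertices has the clique
  counts of the Turan graph.\<close>

lemma zykov:
  assumes "finite V" "symp R" "irreflp R" "clq R V (Suc r) = {}" "r > 0"
  shows "card (clq R V j) \<le> turan_cliques r j (card V)"
  using assms
proof (induction arbitrary: j rule: clique_free_induct)
  case (complete V R)
  then show ?case by (simp add: card_clq_complete turan_cliques_small)
next
  case (edge V R u v)
  have "clq R V j \<subseteq> clq (\<lambda>x y. R x y \<or> {x, y} = {u, v}) V j"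
    by (intro clq_mono) auto
  then show ?case using edge.IH edge.hyps(1) by (meson card_mono finite_clq le_trans)
next
  case (clique V R K)
  have K: "K \<subseteq> V" "card K = r" "pairwise R K" "finite K" using clique by (auto simp: clq_iff)
  then have cV: "card (V - K) = card V - r" "r \<le> card V"
    using clique.hyps(1) card_mono[of V K] by (auto simp: card_Diff_subset)
  have "card (clq R V j) = (\<Sum>i\<le>j. \<Sum>Q\<in>clq R (V - K) i. card {x\<in>K. \<forall>q\<in>Q. R x q} choose (j - i))"
    by (rule card_clq_split) (use clique.hyps K in auto)
  also have "\<dots> \<le> (\<Sum>i\<le>j. \<Sum>Q\<in>clq R (V - K) i. (r - i) choose (j - i))"
    using card_common_neighbours_le[OF clique.hyps(1,2,4,5)] by (intro sum_mono binomial_right_mono)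
  also have "\<dots> \<le> (\<Sum>i\<le>j. turan_cliques r i (card V - r) * ((r - i) choose (j - i)))"
    using clique.IH cV by (auto intro!: sum_mono)
  also have "\<dots> = turan_cliques r j (card V)"
    using turan_cliques_rec[OF \<open>r > 0\<close> cV(2)] by simp
  finally show ?case .
qed

section \<open>Stability of clique counts\<close>

lemma missed_by_good:
  assumes "finite K" "card K = r" "r \<le> Suc (card {x\<in>K. R x v})"
  shows "card {x\<in>K. \<not> R x v} \<le> 1"
proof -
  have "{x\<in>K. \<not> R x v} = K - {x\<in>K. R x v}" by auto
  then have "card {x\<in>K. \<not> R x v} = r - card {x\<in>K. R x v}"
    using assms by (simp add: card_Diff_subset)
  then show ?thesis using assms by simp
qed

text \<open>Each vertex of Q excludes at most one vertex of K. If all vertices of Q have this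
  property, the common neighbourhood is as large as in the Turan graph.\<close>

lemma card_common_neighbours_ge:
  assumes "finite K" "card K = r" "finite Q" "\<And>v. v \<in> Q \<Longrightarrow> r \<le> Suc (card {x\<in>K. R x v})"
  shows "r - card Q \<le> card {x\<in>K. \<forall>v\<in>Q. R x v}"
proof -
  have "K - {x\<in>K. \<forall>v\<in>Q. R x v} = (\<Union>v\<in>Q. {x\<in>K. \<not> R x v})" by auto
  then have "card (K - {x\<in>K. \<forall>v\<in>Q. R x v}) \<le> (\<Sum>v\<in>Q. card {x\<in>K. \<not> R x v})"
    using assms(3) by (simp add: card_UN_le)
  also have "\<dots> \<le> (\<Sum>v\<in>Q. 1)"
    by (intro sum_mono missed_by_good[OF assms(1,2)] assms(4))
  finally have "card (K - {x\<in>K. \<forall>v\<in>Q. R x v}) \<le> card Q" by simp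
  moreover have "card (K - {x\<in>K. \<forall>v\<in>Q. R x v}) = r - card {x\<in>K. \<forall>v\<in>Q. R x v}"
    using assms(1,2) by (simp add: card_Diff_subset)
  ultimately show ?thesis by simp
qed

text \<open>The subtraction does not truncate on graphs without \<open>(r + 1)\<close>-cliques, by Zykov's theorem.\<close>

definition edge_deficit :: "nat \<Rightarrow> ('a \<Rightarrow> 'a \<Rightarrow> bool) \<Rightarrow> 'a set \<Rightarrow> nat" where
  "edge_deficit r R V = turan_cliques r 2 (card V) - card (clq R V 2)"

lemma turan_cliques_0 [simp]: "turan_cliques r 0 n = 1"
  by (simp add: turan_cliques_def)

lemma turan_cliques_1 [simp]: "turan_cliques r (Suc 0) n = n"
  by (simp add: turan_cliques_def card_clq_1)

text \<open>Without (r+1)-cliques an outside vertex has at most r - 1 neighbours in an r-clique K.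
  The poor vertices are those that stay below this maximum; each costs at least one edge.\<close>

definition poor :: "('a \<Rightarrow> 'a \<Rightarrow> bool) \<Rightarrow> 'a set \<Rightarrow> 'a set \<Rightarrow> 'a set" where
  "poor R V K = {v \<in> V - K. Suc (card {x\<in>K. R x v}) < card K}"

text \<open>Between K and the remaining vertices there are at most (n - r)(r - 1) edges, at least
  one fewer for each poor vertex, and the Turan graph attains this maximum.\<close>

lemma edge_deficit_remove_clique:
  assumes "finite V" "symp R" "irreflp R" "clq R V (Suc r) = {}" "r > 0" "K \<in> clq R V r"
    "clq R (V - K) (Suc r) = {}"
  shows "card (poor R V K) + edge_deficit r R (V - K) \<le> edge_deficit r R V"
proof -
  let ?d = "\<lambda>v. card {x\<in>K. R x v}" and ?n = "card V"
  have K: "K \<subseteq> V" "card K = r" "pairwise R K" "finite K" using assms by (auto simp: clq_iff)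
  then have cV: "card (V - K) = ?n - r" "r \<le> ?n"
    using assms(1) card_mono[of V K] by (auto simp: card_Diff_subset)
  have N: "card (clq R V 2) = (r choose 2) + (\<Sum>v\<in>V - K. ?d v) + card (clq R (V - K) 2)"
    by (rule card_edges_split[OF assms(1,2,6)])
  have T: "turan_cliques r 2 ?n = (r choose 2) + (?n - r) * (r - 1) + turan_cliques r 2 (?n - r)"
    using turan_cliques_rec[OF assms(5) cV(2), of 2] by (simp add: numeral_2_eq_2)
  have "(\<Sum>v\<in>V - K. ?d v) + card (poor R V K) = (\<Sum>v\<in>V - K. ?d v + (if v \<in> poor R V K then 1 else 0))"
    using assms(1) by (simp add: sum.distrib poor_def sum.If_cases Int_def)
  also have "\<dots> \<le> (\<Sum>v\<in>V - K. r - 1)"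
  proof (rule sum_mono)
    fix v assume v: "v \<in> V - K"
    then have "{v} \<in> clq R (V - K) (Suc 0)" by (simp add: clq_1)
    from card_common_neighbours_le[OF assms(1,2,4,6) this]
    have "?d v \<le> r - 1" by simp
    then show "?d v + (if v \<in> poor R V K then 1 else 0) \<le> r - 1"
      using K by (auto simp: poor_def)
  qed
  also have "\<dots> = (?n - r) * (r - 1)" using cV by simp
  finally have S: "(\<Sum>v\<in>V - K. ?d v) + card (poor R V K) \<le> (?n - r) * (r - 1)" .
  have "card (clq R (V - K) 2) \<le> turan_cliques r 2 (?n - r)"
    using zykov[of "V - K" R r 2] assms cV by auto
  then show ?thesis using N T S unfolding edge_deficit_def cV(1) by linarith
qed

lemma edge_deficit_add_edge:
  assumes "finite V" "symp R" "irreflp R" "u \<in> V" "v \<in> V" "u \<noteq> v" "\<not> R u v" "r > 0"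
    "symp (\<lambda>x y. R x y \<or> {x, y} = {u, v})" "irreflp (\<lambda>x y. R x y \<or> {x, y} = {u, v})"
    "clq (\<lambda>x y. R x y \<or> {x, y} = {u, v}) V (Suc r) = {}"
  shows "edge_deficit r R V = Suc (edge_deficit r (\<lambda>x y. R x y \<or> {x, y} = {u, v}) V)"
proof -
  let ?R = "\<lambda>x y. R x y \<or> {x, y} = {u, v}"
  have "clq ?R V 2 = insert {u, v} (clq R V 2)"
  proof (intro set_eqI iffI)
    fix e assume "e \<in> clq ?R V 2"
    then show "e \<in> insert {u, v} (clq R V 2)"
      using pair_in_clq_2[OF assms(9)] pair_in_clq_2[OF assms(2)]
      by (auto simp: clq_iff card_2_iff pairwise_def)
  next
    fix e assume "e \<in> insert {u, v} (clq R V 2)"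
    then show "e \<in> clq ?R V 2"
      using pair_in_clq_2[OF assms(9), of u v V] assms(4-6) clq_mono[of V V R ?R 2] by auto
  qed
  moreover have "{u, v} \<notin> clq R V 2" using pair_in_clq_2[OF assms(2)] assms(7) by simp
  ultimately have "card (clq ?R V 2) = Suc (card (clq R V 2))" using assms(1) by simp
  moreover have "card (clq ?R V 2) \<le> turan_cliques r 2 (card V)"
    by (rule zykov[OF assms(1,9,10,11,8)])
  ultimately show ?thesis by (simp add: edge_deficit_def)
qed

lemma card_nsets_meeting_le:
  assumes "finite V" "finite X"
  shows "card {Q \<in> [V]\<^bsup>i\<^esup>. Q \<inter> X \<noteq> {}} \<le> card X * card V ^ (i - 1)"
proof -
  have "{Q \<in> [V]\<^bsup>i\<^esup>. Q \<inter> X \<noteq> {}} = (\<Union>x\<in>X. {Q \<in> [V]\<^bsup>i\<^esup>. {x} \<subseteq> Q})" by auto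
  then have "card {Q \<in> [V]\<^bsup>i\<^esup>. Q \<inter> X \<noteq> {}} \<le> (\<Sum>x\<in>X. card {Q \<in> [V]\<^bsup>i\<^esup>. {x} \<subseteq> Q})"
    using assms(2) by (simp add: card_UN_le)
  also have "\<dots> \<le> (\<Sum>x\<in>X. card V ^ (i - 1))"
    using card_nsets_superset_le[OF assms(1), of "{_}" i] by (intro sum_mono) simp
  finally show ?thesis by simp
qed

lemma binomial_le_two_power: "n choose k \<le> 2 ^ n"
proof (cases "k \<le> n")
  case True
  have "n choose k \<le> (\<Sum>k\<le>n. n choose k)"
    by (rule member_le_sum) (use True in auto)
  then show ?thesis by (simp add: choose_row_sum)
qed (simp add: binomial_eq_0)

text \<open>Against the Turan recursion only cliques Q through a poor vertex can lose: with b poor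
  vertices there are at most b n^(i-1) of them, each losing at most 2^r. For i = 0 and i = j nothing
  is lost, as all of K is available or the binomial coefficient is 1. So i \<le> j - 1, and the
  exponent stays at most j - 2.\<close>

lemma clique_count_remove_clique:
  assumes "finite V" "symp R" "clq R V (Suc r) = {}" "K \<in> clq R V r" "j \<le> r" "2 \<le> j"
  shows "(\<Sum>i\<le>j. card (clq R (V - K) i) * ((r - i) choose (j - i)))
    \<le> card (clq R V j) + r * 2 ^ r * card (poor R V K) * card V ^ (j - 2)"
proof -
  let ?n = "card V" and ?b = "card (poor R V K)"
  let ?N = "\<lambda>Q. {x\<in>K. \<forall>q\<in>Q. R x q}"
  have K: "K \<subseteq> V" "card K = r" "pairwise R K" "finite K" using assms by (auto simp: clq_iff)
  have "K \<noteq> {}" using K assms by auto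
  then have n: "?n \<ge> 1" using K assms(1) card_mono[of V K] assms(5,6) by simp
  have finb: "finite (poor R V K)" using assms(1) by (simp add: poor_def)
  have 1: "card (clq R (V - K) i) * ((r - i) choose (j - i))
    \<le> (\<Sum>Q\<in>clq R (V - K) i. card (?N Q) choose (j - i)) + (if i \<in> {1..<j} then ?b * ?n ^ (j - 2) * 2 ^ r else 0)"
    if ij: "i \<le> j" for i
  proof -
    consider "i = 0" | "i = j" | "i \<in> {1..<j}"
      using ij by (cases "i = 0"; cases "i = j") auto
    then show ?thesis
    proof cases
      case 3
      let ?C = "clq R (V - K) i" and ?M = "{Q \<in> [V]\<^bsup>i\<^esup>. Q \<inter> poor R V K \<noteq> {}}"
      have "card ?C * ((r - i) choose (j - i)) = (\<Sum>Q\<in>?C. (r - i) choose (j - i))" by simp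
      also have "\<dots> \<le> (\<Sum>Q\<in>?C. (card (?N Q) choose (j - i)) + (if Q \<inter> poor R V K = {} then 0 else 2 ^ r))"
      proof (rule sum_mono)
        fix Q assume Q: "Q \<in> ?C"
        show "(r - i) choose (j - i) \<le> (card (?N Q) choose (j - i)) + (if Q \<inter> poor R V K = {} then 0 else 2 ^ r)"
        proof (cases "Q \<inter> poor R V K = {}")
          case True
          have "r - card Q \<le> card (?N Q)"
            by (rule card_common_neighbours_ge)
              (use True Q K in \<open>auto simp: clq_iff poor_def not_less\<close>)
          then show ?thesis using Q by (auto simp: clq_iff intro: trans_le_add1 binomial_right_mono)
        next
          case False
          have "(r - i) choose (j - i) \<le> 2 ^ (r - i)" by (rule binomial_le_two_power)
          also have "\<dots> \<le> 2 ^ r" by (rule power_increasing) auto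
          finally show ?thesis using False by simp
        qed
      qed
      also have "\<dots> = (\<Sum>Q\<in>?C. card (?N Q) choose (j - i)) + card {Q\<in>?C. Q \<inter> poor R V K \<noteq> {}} * 2 ^ r"
        using assms(1) by (simp add: sum.distrib sum.If_cases Int_def)
      also have "card {Q\<in>?C. Q \<inter> poor R V K \<noteq> {}} \<le> card ?M"
        using assms(1) by (intro card_mono) (auto simp: clq_iff nsets_def)
      also have "card ?M \<le> ?b * ?n ^ (i - 1)"
        by (rule card_nsets_meeting_le[OF assms(1) finb])
      also have "?n ^ (i - 1) \<le> ?n ^ (j - 2)"
        using n 3 by (intro power_increasing) auto
      finally show ?thesis using 3 by simp
    qed (use K in auto)
  qed
  have "(\<Sum>i\<le>j. card (clq R (V - K) i) * ((r - i) choose (j - i)))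
    \<le> (\<Sum>i\<le>j. (\<Sum>Q\<in>clq R (V - K) i. card (?N Q) choose (j - i)) + (if i \<in> {1..<j} then ?b * ?n ^ (j - 2) * 2 ^ r else 0))"
    by (intro sum_mono 1) simp
  also have "\<dots> = card (clq R V j) + (\<Sum>i\<le>j. if i \<in> {1..<j} then ?b * ?n ^ (j - 2) * 2 ^ r else 0)"
    using card_clq_split[OF assms(1,2) K(1,3), of j] by (simp add: sum.distrib)
  also have "(\<Sum>i\<le>j. if i \<in> {1..<j} then ?b * ?n ^ (j - 2) * 2 ^ r else 0) = (\<Sum>i\<in>{1..<j}. ?b * ?n ^ (j - 2) * 2 ^ r)"
    by (rule sum.mono_neutral_cong_right) auto
  also have "\<dots> = (j - 1) * (?b * ?n ^ (j - 2) * 2 ^ r)" by simp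
  also have "\<dots> \<le> r * (?b * ?n ^ (j - 2) * 2 ^ r)" using assms(5) by (intro mult_right_mono) auto
  finally show ?thesis by (simp add: mult_ac)
qed

text \<open>The binomial coefficients are at most powers of r, and inserting the factors
  \<open>(j - 2) choose i\<close>, which are at least 1, yields the binomial theorem. With m = n - r
  the result is n^(j-2), so error terms survive the removal of a clique with an unchanged
  constant.\<close>

lemma sum_power_binomial_le:
  assumes "2 \<le> j" "j \<le> r"
  shows "(\<Sum>i\<in>{2..j}. m ^ (i - 2) * ((r - i) choose (j - i))) \<le> (m + r) ^ (j - 2 :: nat)"
proof -
  have "(\<Sum>i\<in>{2..j}. m ^ (i - 2) * ((r - i) choose (j - i))) = (\<Sum>i\<le>j - 2. m ^ i * ((r - (i + 2)) choose (j - (i + 2))))"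
    by (rule sum.reindex_bij_witness[of _ "\<lambda>i. i + 2" "\<lambda>i. i - 2"]) (use assms in \<open>auto simp del: add_2_eq_Suc add_2_eq_Suc'\<close>)
  also have "\<dots> \<le> (\<Sum>i\<le>j - 2. of_nat ((j - 2) choose i) * m ^ i * r ^ (j - 2 - i))"
  proof (rule sum_mono)
    fix i assume i: "i \<in> {..j - 2}"
    have "(r - (i + 2)) choose (j - (i + 2)) \<le> (r - (i + 2)) ^ (j - (i + 2))"
      using assms i by (intro binomial_le_pow) auto
    also have "\<dots> \<le> r ^ (j - (i + 2))" by (intro power_mono) auto
    also have "j - (i + 2) = j - 2 - i" by simp
    finally have "(r - (i + 2)) choose (j - (i + 2)) \<le> 1 * r ^ (j - 2 - i)" by simp
    also have "\<dots> \<le> ((j - 2) choose i) * r ^ (j - 2 - i)"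
      using i by (intro mult_right_mono) (auto simp: Suc_le_eq)
    finally have "m ^ i * ((r - (i + 2)) choose (j - (i + 2))) \<le> m ^ i * (((j - 2) choose i) * r ^ (j - 2 - i))"
      by (rule mult_left_mono) simp
    then show "m ^ i * ((r - (i + 2)) choose (j - (i + 2))) \<le> of_nat ((j - 2) choose i) * m ^ i * r ^ (j - 2 - i)"
      by (simp add: mult_ac)
  qed
  also have "\<dots> = (m + r) ^ (j - 2)" by (rule binomial_ring[symmetric])
  finally show ?thesis .
qed

text \<open>Each unit of the deficit accounts for at most r 2^r n^(j-2) missing j-cliques. An added
  edge creates only cliques that contain both its ends, at most n^(j-2) of them; a poor vertex costs
  what \<open>clique_count_remove_clique\<close> allows.\<close>

lemma clique_deficit:
  assumes "finite V" "symp R" "irreflp R" "clq R V (Suc r) = {}" "r > 0" "2 \<le> j" "j \<le> r"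
  shows "turan_cliques r j (card V) \<le> card (clq R V j) + r * 2 ^ r * edge_deficit r R V * card V ^ (j - 2)"
  using assms
proof (induction arbitrary: j rule: clique_free_induct)
  case (complete V R)
  then show ?case by (simp add: card_clq_complete turan_cliques_small)
next
  case (edge V R u v)
  let ?R = "\<lambda>x y. R x y \<or> {x, y} = {u, v}" and ?n = "card V"
  have d: "edge_deficit r R V = Suc (edge_deficit r ?R V)"
    by (rule edge_deficit_add_edge) (use edge.hyps \<open>r > 0\<close> in auto)
  have "clq ?R V j \<subseteq> clq R V j \<union> {Q \<in> [V]\<^bsup>j\<^esup>. {u, v} \<subseteq> Q}"
  proof
    fix Q assume Q: "Q \<in> clq ?R V j"
    show "Q \<in> clq R V j \<union> {Q \<in> [V]\<^bsup>j\<^esup>. {u, v} \<subseteq> Q}"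
    proof (cases "pairwise R Q")
      case True
      then show ?thesis using Q by (simp add: clq_iff)
    next
      case False
      then obtain x y where "x \<in> Q" "y \<in> Q" "x \<noteq> y" "\<not> R x y" by (auto simp: pairwise_def)
      then have "{x, y} = {u, v}" using Q by (auto simp: clq_iff pairwise_def)
      then have "{u, v} \<subseteq> Q" using \<open>x \<in> Q\<close> \<open>y \<in> Q\<close> by (metis empty_subsetI insert_subset)
      then show ?thesis using Q by (simp add: clq_iff nsets_def)
    qed
  qed
  then have "card (clq ?R V j) \<le> card (clq R V j \<union> {Q \<in> [V]\<^bsup>j\<^esup>. {u, v} \<subseteq> Q})"
    using edge.hyps(1) by (intro card_mono) (auto simp: finite_imp_finite_nsets)
  also have "\<dots> \<le> card (clq R V j) + ?n ^ (j - 2)"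
    using card_nsets_superset_le[of V "{u, v}" j] edge.hyps
    by (intro order_trans[OF card_Un_le]) (auto simp: numeral_2_eq_2)
  also have "?n ^ (j - 2) \<le> r * 2 ^ r * ?n ^ (j - 2)" using \<open>r > 0\<close> by simp
  finally show ?case using edge.IH[OF edge.prems] d by (simp add: algebra_simps)
next
  case (clique V R K)
  let ?n = "card V" and ?C = "r * 2 ^ r" and ?b = "card (poor R V K)" and ?e = "edge_deficit r R (V - K)"
  have K: "K \<subseteq> V" "card K = r" "pairwise R K" "finite K" using clique by (auto simp: clq_iff)
  then have cV: "card (V - K) = ?n - r" "r \<le> ?n"
    using clique.hyps(1) card_mono[of V K] by (auto simp: card_Diff_subset)
  have d: "?b + ?e \<le> edge_deficit r R V"
    by (rule edge_deficit_remove_clique) (use clique.hyps \<open>r > 0\<close> in auto)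
  \<comment> \<open>For i \<le> 1 the counts depend only on the number of vertices, so there is no
    error term and the exponent i - 2 is used only where it does not truncate.\<close>
  have t: "turan_cliques r i (?n - r) \<le> card (clq R (V - K) i) + (if i \<in> {2..j} then ?C * ?e * (?n - r) ^ (i - 2) else 0)"
    if "i \<le> j" for i
  proof -
    consider "i = 0" | "i = 1" | "2 \<le> i" by linarith
    then show ?thesis
    proof cases
      case 3
      then show ?thesis using clique.IH[of i] that clique.prems cV by simp
    qed (use clique.hyps(1) cV in \<open>auto simp: card_clq_1\<close>)
  qed
  have "turan_cliques r j ?n = (\<Sum>i\<le>j. turan_cliques r i (?n - r) * ((r - i) choose (j - i)))"
    using turan_cliques_rec[OF \<open>r > 0\<close> cV(2)] by simp
  also have "\<dots> \<le> (\<Sum>i\<le>j. (card (clq R (V - K) i) + (if i \<in> {2..j} then ?C * ?e * (?n - r) ^ (i - 2) else 0)) * ((r - i) choose (j - i)))"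
    by (intro sum_mono mult_right_mono t) auto
  also have "\<dots> = (\<Sum>i\<le>j. card (clq R (V - K) i) * ((r - i) choose (j - i)))
      + (\<Sum>i\<le>j. (if i \<in> {2..j} then ?C * ?e * (?n - r) ^ (i - 2) else 0) * ((r - i) choose (j - i)))"
    by (simp add: add_mult_distrib sum.distrib)
  also have "(\<Sum>i\<le>j. (if i \<in> {2..j} then ?C * ?e * (?n - r) ^ (i - 2) else 0) * ((r - i) choose (j - i)))
      = (\<Sum>i\<in>{2..j}. ?C * ?e * ((?n - r) ^ (i - 2) * ((r - i) choose (j - i))))"
    by (rule sum.mono_neutral_cong_right) auto
  also have "\<dots> = ?C * ?e * (\<Sum>i\<in>{2..j}. (?n - r) ^ (i - 2) * ((r - i) choose (j - i)))"
    by (simp add: sum_distrib_left)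
  also have "\<dots> \<le> ?C * ?e * (?n - r + r) ^ (j - 2)"
    using sum_power_binomial_le clique.prems by (intro mult_left_mono) auto
  also have "?n - r + r = ?n" using cV by simp
  also have "(\<Sum>i\<le>j. card (clq R (V - K) i) * ((r - i) choose (j - i)))
      \<le> card (clq R V j) + ?C * ?b * ?n ^ (j - 2)"
    by (rule clique_count_remove_clique) (use clique.hyps clique.prems in auto)
  also have "card (clq R V j) + ?C * ?b * ?n ^ (j - 2) + ?C * ?e * ?n ^ (j - 2)
      = card (clq R V j) + ?C * (?b + ?e) * ?n ^ (j - 2)"
    by (simp add: algebra_simps)
  also have "\<dots> \<le> card (clq R V j) + ?C * edge_deficit r R V * ?n ^ (j - 2)"
    using d by (intro add_left_mono mult_right_mono mult_left_mono) auto
  finally show ?case by simp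
qed

section \<open>Edges together with a common non-neighbour\<close>

text \<open>
  Such triples obstruct non-adjacency from being transitive: without them, the graph is complete
  multipartite. Their number therefore measures the distance to the Turan graph.
\<close>

definition nonadj_triples :: "('a \<Rightarrow> 'a \<Rightarrow> bool) \<Rightarrow> 'a set \<Rightarrow> ('a \<times> 'a \<times> 'a) set" where
  "nonadj_triples R V = {(x, y, z). x \<in> V \<and> y \<in> V \<and> z \<in> V \<and> R y z \<and> \<not> R x y \<and> \<not> R x z}"

lemma finite_nonadj_triples: "finite V \<Longrightarrow> finite (nonadj_triples R V)"
  by (rule finite_subset[of _ "V \<times> V \<times> V"]) (auto simp: nonadj_triples_def)

text \<open>A vertex that is not poor misses at most one vertex of K. If y and z both missed x, they
  would both be adjacent to all of K - {x}, and replacing x by y and z would give an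
  (r+1)-clique.\<close>

lemma rich_adjacent_miss_distinct:
  assumes "finite V" "symp R" "irreflp R" "clq R V (Suc r) = {}" "K \<in> clq R V r"
    "clq R (V - K) (Suc r) = {}"
    "y \<in> V - K - poor R V K" "z \<in> V - K - poor R V K" "R y z" "x \<in> K" "\<not> R x y"
  shows "R x z"
proof (rule ccontr)
  assume nz: "\<not> R x z"
  have K: "K \<subseteq> V" "card K = r" "finite K" using assms(5) by (auto simp: clq_iff)
  have "y \<noteq> z" using assms(3,9) by (auto simp: irreflp_def)
  have Q: "{y, z} \<in> clq R (V - K) 2" using assms \<open>y \<noteq> z\<close> by (simp add: pair_in_clq_2)
  have missed: "{w\<in>K. \<not> R w v} \<subseteq> {x}" if "v \<in> V - K - poor R V K" "\<not> R x v" for v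
  proof -
    have "card {w\<in>K. \<not> R w v} \<le> 1"
      using that K by (intro missed_by_good[of _ r]) (auto simp: poor_def)
    then show ?thesis
      using that(2) assms(10) K(3) by (auto simp: card_le_Suc0_iff_eq)
  qed
  have "K - {x} \<subseteq> {w\<in>K. \<forall>q\<in>{y, z}. R w q}"
    using missed[OF assms(7,11)] missed[OF assms(8) nz] by auto
  then have "r - 1 \<le> card {w\<in>K. \<forall>q\<in>{y, z}. R w q}"
    using K assms(10) card_mono[of "{w\<in>K. \<forall>q\<in>{y, z}. R w q}" "K - {x}"] by simp
  also have "\<dots> \<le> r - 2"
    using card_common_neighbours_le[OF assms(1,2,4,5) Q] .
  \<comment> \<open>Natural subtraction leaves the case r = 1 open; there the edge {y, z} itself is
    the forbidden clique.\<close>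
  finally have "r \<le> 1" by simp
  moreover have "r \<noteq> 0" using K assms(10) card_gt_0_iff[of K] by auto
  ultimately have "Suc r = 2" by simp
  then show False using Q assms(6) by (simp add: numeral_2_eq_2)
qed

text \<open>Outside the poor vertices the choice is forced. It serves as a class label: the vertices
  of K index the classes of a multipartite graph that approximates the given one.\<close>

definition missed_vertex :: "('a \<Rightarrow> 'a \<Rightarrow> bool) \<Rightarrow> 'a set \<Rightarrow> 'a \<Rightarrow> 'a" where
  "missed_vertex R K v = (SOME x. x \<in> K \<and> \<not> R x v)"

lemma missed_vertex:
  assumes "finite V" "symp R" "clq R V (Suc r) = {}" "K \<in> clq R V r" "r > 0"
    "v \<in> V - K - poor R V K"
  shows "missed_vertex R K v \<in> K" "x \<in> K \<Longrightarrow> \<not> R x v \<longleftrightarrow> x = missed_vertex R K v"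
proof -
  have K: "K \<subseteq> V" "card K = r" "finite K" using assms(4) by (auto simp: clq_iff)
  have "{v} \<in> clq R (V - K) (Suc 0)" using assms by (simp add: clq_1)
  from card_common_neighbours_le[OF assms(1-4) this]
  have "card {x\<in>K. R x v} \<le> r - 1" by simp
  then have "{x\<in>K. R x v} \<noteq> K" using K assms(5) by auto
  then have ex: "\<exists>x. x \<in> K \<and> \<not> R x v" by auto
  have m: "missed_vertex R K v \<in> K \<and> \<not> R (missed_vertex R K v) v"
    unfolding missed_vertex_def by (rule someI_ex[OF ex])
  then show "missed_vertex R K v \<in> K" by simp
  have "card {w\<in>K. \<not> R w v} \<le> 1"
    using assms K by (intro missed_by_good[of _ r]) (auto simp: poor_def)
  then show "x \<in> K \<Longrightarrow> \<not> R x v \<longleftrightarrow> x = missed_vertex R K v"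
    using m K(3) by (auto simp: card_le_Suc0_iff_eq)
qed

text \<open>Compare with the complete multipartite graph \<open>R'\<close> on the non-poor vertices,
  whose classes are given by the labels. It contains every edge of R in V - K that avoids poor
  vertices, and with only r labels it has no (r+1)-clique. Zykov's theorem bounds its edges, hence
  also those of its edges that R lacks.\<close>

lemma card_cross_missing:
  assumes "finite V" "symp R" "irreflp R" "clq R V (Suc r) = {}" "r > 0" "K \<in> clq R V r"
    "clq R (V - K) (Suc r) = {}"
  defines "G \<equiv> V - K - poor R V K"
  defines "m \<equiv> missed_vertex R K"
  shows "card {(x, z). x \<in> G \<and> z \<in> G \<and> m x \<noteq> m z \<and> \<not> R x z}
    \<le> 4 * (edge_deficit r R (V - K) + card (poor R V K) * card V)"
proof -
  define R' where "R' = (\<lambda>x z. x \<in> G \<and> z \<in> G \<and> m x \<noteq> m z)"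
  have sym': "symp R'" and irr': "irreflp R'" by (auto simp: R'_def symp_def irreflp_def)
  have K: "K \<subseteq> V" "card K = r" "finite K" using assms(6) by (auto simp: clq_iff)
  have mK: "m x \<in> K" if "x \<in> G" for x
    using missed_vertex(1)[OF assms(1,2,4,6,5)] that by (simp add: m_def G_def)
  have free': "clq R' (V - K) (Suc r) = {}"
  proof (rule ccontr)
    assume "clq R' (V - K) (Suc r) \<noteq> {}"
    then obtain Q where Q: "finite Q" "card Q = Suc r" "pairwise R' Q" by (auto simp: clq_iff)
    have "Q \<subseteq> G"
    proof
      fix x assume "x \<in> Q"
      then have "Q \<noteq> {x}" using Q assms(5) by auto
      then obtain y where "y \<in> Q" "y \<noteq> x" using \<open>x \<in> Q\<close> by blast
      then have "R' x y" using Q(3) \<open>x \<in> Q\<close> by (auto simp: pairwise_def)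
      then show "x \<in> G" by (simp add: R'_def)
    qed
    then have "m ` Q \<subseteq> K" using mK by auto
    moreover have "inj_on m Q"
      using Q(3) unfolding inj_on_def pairwise_def R'_def by blast
    ultimately have "card Q \<le> card K" using K(3) card_inj_on_le by blast
    then show False using Q K by simp
  qed
  have fin: "finite (V - K)" "finite (poor R V K)" using assms(1) by (auto simp: poor_def)
  let ?D = "clq R' (V - K) 2 - clq R (V - K) 2" and ?I = "clq R' (V - K) 2 \<inter> clq R (V - K) 2"
  have "clq R (V - K) 2 \<subseteq> ?I \<union> {Q \<in> [V]\<^bsup>2\<^esup>. Q \<inter> poor R V K \<noteq> {}}"
  proof
    fix e assume e: "e \<in> clq R (V - K) 2"
    then obtain y z where yz: "e = {y, z}" by (auto simp: clq_iff card_2_iff)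
    then have *: "y \<in> V - K" "z \<in> V - K" "y \<noteq> z" "R y z"
      using e assms(2) by (auto simp: pair_in_clq_2)
    show "e \<in> ?I \<union> {Q \<in> [V]\<^bsup>2\<^esup>. Q \<inter> poor R V K \<noteq> {}}"
    proof (cases "y \<in> poor R V K \<or> z \<in> poor R V K")
      case True
      then show ?thesis using e yz by (auto simp: clq_iff nsets_def)
    next
      case False
      then have g: "y \<in> V - K - poor R V K" "z \<in> V - K - poor R V K" using * by auto
      note mv = missed_vertex[OF assms(1,2,4,6,5)]
      have "R (m y) z"
        using rich_adjacent_miss_distinct[OF assms(1-4,6,7) g *(4)] mv[OF g(1)] by (simp add: m_def)
      then have "m y \<noteq> m z" using mv(2)[OF g(2) mv(1)[OF g(2)]] by (auto simp: m_def)
      then have "e \<in> clq R' (V - K) 2"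
        unfolding yz using * g by (subst pair_in_clq_2[OF sym']) (auto simp: R'_def G_def)
      then show ?thesis using e by simp
    qed
  qed
  then have "card (clq R (V - K) 2) \<le> card (?I \<union> {Q \<in> [V]\<^bsup>2\<^esup>. Q \<inter> poor R V K \<noteq> {}})"
    using fin assms(1) by (intro card_mono) (auto simp: finite_imp_finite_nsets)
  also have "\<dots> \<le> card ?I + card (poor R V K) * card V"
    using card_nsets_meeting_le[OF assms(1) fin(2), of 2]
    by (intro order_trans[OF card_Un_le]) simp
  finally have 1: "card (clq R (V - K) 2) \<le> card ?I + card (poor R V K) * card V" .
  have "card ?D + card ?I = card (clq R' (V - K) 2)"
    using fin(1) by (metis Int_Diff_Un Int_Diff_disjoint Int_commute add.commute card_Un_disjoint finite_Diff finite_Int finite_clq)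
  also have "\<dots> \<le> turan_cliques r 2 (card (V - K))"
    by (rule zykov[OF fin(1) sym' irr' free' assms(5)])
  finally have 2: "card ?D + card ?I \<le> turan_cliques r 2 (card (V - K))" .
  have D: "card ?D \<le> edge_deficit r R (V - K) + card (poor R V K) * card V"
    using 1 2 unfolding edge_deficit_def by linarith
  have "{(x, z). x \<in> G \<and> z \<in> G \<and> m x \<noteq> m z \<and> \<not> R x z} \<subseteq> (\<Union>e\<in>?D. e \<times> e)"
  proof clarify
    fix x z assume *: "x \<in> G" "z \<in> G" "m x \<noteq> m z" "\<not> R x z"
    then have "{x, z} \<in> ?D"
      unfolding Diff_iff pair_in_clq_2[OF sym'] pair_in_clq_2[OF assms(2)] by (auto simp: R'_def G_def)
    then show "(x, z) \<in> (\<Union>e\<in>?D. e \<times> e)" by blast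
  qed
  moreover have "finite (\<Union>e\<in>?D. e \<times> e)" using fin(1) by (auto simp: clq_iff)
  ultimately have "card {(x, z). x \<in> G \<and> z \<in> G \<and> m x \<noteq> m z \<and> \<not> R x z} \<le> card (\<Union>e\<in>?D. e \<times> e)"
    by (rule card_mono[rotated])
  also have "\<dots> \<le> (\<Sum>e\<in>?D. card (e \<times> e))"
    using fin(1) by (intro card_UN_le) auto
  \<comment> \<open>The products also contain the two diagonal pairs; this is harmless and is the
    origin of the factor 4.\<close>
  also have "\<dots> = (\<Sum>e\<in>?D. 4)"
    by (intro sum.cong) (auto simp: clq_iff card_cartesian_product)
  also have "\<dots> = 4 * card ?D" by simp
  also have "\<dots> \<le> 4 * (edge_deficit r R (V - K) + card (poor R V K) * card V)"
    using D by (rule mult_le_mono2)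
  finally show ?thesis .
qed

text \<open>Consider a triple (x, y, z) that meets K but is not covered by a vertex of K and a poor
  vertex. By \<open>rich_adjacent_miss_distinct\<close> x is outside K, so y or z is the vertex of K
  missed by x. The third vertex cannot lie in K too; being adjacent to the label of x, it has a
  different label, and it is not adjacent to x. It forms with x a pair counted in
  \<open>card_cross_missing\<close>.\<close>

lemma nonadj_triples_remove_clique:
  assumes "finite V" "symp R" "irreflp R" "clq R V (Suc r) = {}" "r > 0" "K \<in> clq R V r"
    "clq R (V - K) (Suc r) = {}"
  shows "card (nonadj_triples R V) \<le> card (nonadj_triples R (V - K))
    + 14 * r * card (poor R V K) * card V + 8 * edge_deficit r R (V - K)"
proof -
  let ?B = "poor R V K" and ?T = "nonadj_triples R (V - K)"
  define m where "m = missed_vertex R K"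
  define C where "C = {(x, z). x \<in> V - K - ?B \<and> z \<in> V - K - ?B \<and> m x \<noteq> m z \<and> \<not> R x z}"
  have K: "K \<subseteq> V" "card K = r" "finite K" "pairwise R K" using assms(6) by (auto simp: clq_iff)
  have fin: "finite ?B" "finite C" "finite ?T"
    using assms(1) finite_subset[of C "V \<times> V"]
    by (auto simp: poor_def C_def finite_nonadj_triples)
  note mv = missed_vertex[OF assms(1,2,4,6,5)]
  let ?U = "[?T, K \<times> ?B \<times> V, K \<times> V \<times> ?B, ?B \<times> K \<times> V, V \<times> K \<times> ?B, ?B \<times> V \<times> K, V \<times> ?B \<times> K,
    (\<lambda>(x, z). (x, m x, z)) ` C, (\<lambda>(x, y). (x, y, m x)) ` C]"
  have sub: "nonadj_triples R V \<subseteq> \<Union>(set ?U)"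
  proof clarify
    fix x y z assume "(x, y, z) \<in> nonadj_triples R V"
    then have *: "x \<in> V" "y \<in> V" "z \<in> V" "R y z" "\<not> R x y" "\<not> R x z"
      by (auto simp: nonadj_triples_def)
    have ne: "x \<noteq> y" "x \<noteq> z" using * sympD[OF assms(2)] by blast+
    have notK: "y \<notin> K" "z \<notin> K" if "x \<in> K"
      using that * ne K(4) by (auto simp: pairwise_def)
    show "(x, y, z) \<in> \<Union>(set ?U)"
    proof (cases "(x \<notin> K \<and> y \<notin> K \<and> z \<notin> K) \<or> (x \<in> K \<and> (y \<in> ?B \<or> z \<in> ?B))
        \<or> (x \<notin> K \<and> y \<in> K \<and> (x \<in> ?B \<or> z \<in> ?B)) \<or> (x \<notin> K \<and> z \<in> K \<and> (x \<in> ?B \<or> y \<in> ?B))")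
      case True
      then show ?thesis using * by (auto simp: nonadj_triples_def)
    next
      case False
      consider "x \<in> K" | "x \<notin> K" "y \<in> K" | "x \<notin> K" "y \<notin> K" "z \<in> K" using False by blast
      then show ?thesis
      proof cases
        case 1
        then have "y \<in> V - K - ?B" "z \<in> V - K - ?B" using * notK False by auto
        from rich_adjacent_miss_distinct[OF assms(1-4,6,7) this *(4) 1 *(5)]
        show ?thesis using * by simp
      next
        case 2
        then have x: "x \<in> V - K - ?B" using * False by auto
        have y: "y = m x" using mv(2)[OF x 2(2)] *(5) sympD[OF assms(2)] by (auto simp: m_def)
        show ?thesis
        proof (cases "z \<in> K")
          case True
          then have "z = m x" using mv(2)[OF x True] *(6) sympD[OF assms(2)] by (auto simp: m_def)
          then show ?thesis using y * assms(3) by (auto simp: irreflp_def)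
        next
          case zK: False
          then have z: "z \<in> V - K - ?B" using * 2 False by auto
          have "m z \<noteq> y" using mv(2)[OF z 2(2)] *(4) by (auto simp: m_def)
          then have "(x, z) \<in> C" using x y z * by (auto simp: C_def)
          then have "(x, y, z) \<in> (\<lambda>(x, z). (x, m x, z)) ` C" using y by force
          then show ?thesis by simp
        qed
      next
        case 3
        then have x: "x \<in> V - K - ?B" and y: "y \<in> V - K - ?B" using * False by auto
        have z: "z = m x" using mv(2)[OF x 3(3)] *(6) sympD[OF assms(2)] by (auto simp: m_def)
        have "m y \<noteq> z" using mv(2)[OF y 3(3)] *(4) sympD[OF assms(2)] by (auto simp: m_def)
        then have "(x, y) \<in> C" using x y z * by (auto simp: C_def)
        then have "(x, y, z) \<in> (\<lambda>(x, y). (x, y, m x)) ` C" using z by force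
        then show ?thesis by simp
      qed
    qed
  qed
  have "card (nonadj_triples R V) \<le> card (\<Union>(set ?U))"
    using fin K(3) assms(1) by (intro card_mono[OF _ sub]) auto
  also have "\<dots> \<le> sum_list (map card ?U)"
    by (simp del: Un_insert_left Un_insert_right) (intro order_trans[OF card_Un_le] add_mono order_refl)
  \<comment> \<open>Six products of size r b n, for b poor vertices, and two images of
    \<open>C\<close>. As \<open>C\<close> has at most 4 (\<epsilon>' + b n) elements, with
    \<epsilon>' the deficit of V - K, the constants become 14 = 6 + 8 and 8.\<close>
  also have "\<dots> \<le> card ?T + 6 * (r * card ?B * card V) + 2 * card C"
    using K(2) card_image_le[OF fin(2), of "\<lambda>(x, z). (x, m x, z)"]
      card_image_le[OF fin(2), of "\<lambda>(x, y). (x, y, m x)"]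
    by (simp add: card_cartesian_product mult_ac)
  also have "card C \<le> 4 * (edge_deficit r R (V - K) + card ?B * card V)"
    unfolding C_def m_def by (rule card_cross_missing[OF assms])
  also have "card ?B * card V \<le> r * card ?B * card V" using assms(5) by simp
  finally show ?thesis by (simp add: algebra_simps)
qed

text \<open>Adding the edge {u, v} destroys only triples in which x and one of y, z are u and v;
  there are at most 4 n of these. Removing a clique charges its poor vertices to the
  deficit.\<close>

lemma card_nonadj_triples_le:
  assumes "finite V" "symp R" "irreflp R" "clq R V (Suc r) = {}" "r > 0"
  shows "card (nonadj_triples R V) \<le> 14 * r * edge_deficit r R V * card V"
  using assms
proof (induction rule: clique_free_induct)
  case (complete V R)
  then have "nonadj_triples R V = {}"
    by (auto simp: nonadj_triples_def pairwise_def irreflp_def)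
  then show ?case by simp
next
  case (edge V R u v)
  let ?R = "\<lambda>x y. R x y \<or> {x, y} = {u, v}" and ?n = "card V"
  have d: "edge_deficit r R V = Suc (edge_deficit r ?R V)"
    by (rule edge_deficit_add_edge) (use edge.hyps \<open>r > 0\<close> in auto)
  let ?U = "[nonadj_triples ?R V, {u} \<times> {v} \<times> V, {v} \<times> {u} \<times> V, {u} \<times> V \<times> {v}, {v} \<times> V \<times> {u}]"
  have sub: "nonadj_triples R V \<subseteq> \<Union>(set ?U)"
    by (auto simp: nonadj_triples_def doubleton_eq_iff)
  have "card (nonadj_triples R V) \<le> card (\<Union>(set ?U))"
    using edge.hyps(1) by (intro card_mono[OF _ sub]) (auto simp: finite_nonadj_triples)
  also have "\<dots> \<le> sum_list (map card ?U)"
    by (simp del: Un_insert_left Un_insert_right) (intro order_trans[OF card_Un_le] add_mono order_refl)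
  also have "\<dots> = card (nonadj_triples ?R V) + 4 * ?n"
    by (simp add: card_cartesian_product)
  also have "\<dots> \<le> 14 * r * edge_deficit r ?R V * ?n + 14 * r * ?n"
    using edge.IH \<open>r > 0\<close> by (intro add_mono) auto
  finally show ?case using d by (simp add: algebra_simps)
next
  case (clique V R K)
  let ?n = "card V" and ?b = "card (poor R V K)" and ?e = "edge_deficit r R (V - K)"
  have K: "K \<subseteq> V" "card K = r" "finite K" using clique by (auto simp: clq_iff)
  then have cV: "card (V - K) = ?n - r" "r \<le> ?n"
    using clique.hyps(1) card_mono[of V K] by (auto simp: card_Diff_subset)
  have d: "?b + ?e \<le> edge_deficit r R V"
    by (rule edge_deficit_remove_clique) (use clique.hyps \<open>r > 0\<close> in auto)
  have "card (nonadj_triples R V) \<le> card (nonadj_triples R (V - K)) + 14 * r * ?b * ?n + 8 * ?e"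
    by (rule nonadj_triples_remove_clique) (use clique.hyps \<open>r > 0\<close> in auto)
  also have "card (nonadj_triples R (V - K)) \<le> 14 * r * ?e * (?n - r)"
    using clique.IH cV by simp
  \<comment> \<open>The term without a factor n is absorbed by the r vertices of K that the
    induction hypothesis does not count.\<close>
  also have "8 * ?e \<le> 14 * r * ?e * r"
  proof -
    have "1 \<le> r * r" using \<open>r > 0\<close> by (simp add: Suc_le_eq)
    then have "8 \<le> 14 * (r * r)" by linarith
    then have "8 * ?e \<le> 14 * (r * r) * ?e" by (rule mult_right_mono) simp
    then show ?thesis by (simp add: mult_ac)
  qed
  finally have "card (nonadj_triples R V) \<le> 14 * r * ?e * (?n - r) + 14 * r * ?b * ?n + 14 * r * ?e * r"
    by simp
  also have "\<dots> = 14 * r * ?e * (?n - r + r) + 14 * r * ?b * ?n"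
    by (simp only: distrib_left add_ac)
  also have "\<dots> = 14 * r * (?b + ?e) * ?n"
    using cV by (simp add: algebra_simps)
  also have "\<dots> \<le> 14 * r * edge_deficit r R V * ?n"
    using d by (intro mult_right_mono mult_left_mono) auto
  finally show ?case .
qed

section \<open>Disjoint pairs of a clique and an edge\<close>

definition disjoint_pairs :: "('a \<Rightarrow> 'a \<Rightarrow> bool) \<Rightarrow> 'a set \<Rightarrow> nat \<Rightarrow> ('a set \<times> 'a set) set" where
  "disjoint_pairs R V s = (SIGMA Q:clq R V s. clq R (V - Q) 2)"

lemma finite_disjoint_pairs: "finite V \<Longrightarrow> finite (disjoint_pairs R V s)"
  by (auto simp: disjoint_pairs_def)

lemma card_disjoint_pairs:
  "finite V \<Longrightarrow> card (disjoint_pairs R V s) = (\<Sum>Q\<in>clq R V s. card (clq R (V - Q) 2))"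
  by (simp add: disjoint_pairs_def card_SigmaI)

text \<open>Both sides count pairs of an (s+1)-clique and one of its vertices.\<close>

lemma card_clique_extensions:
  assumes "finite V" "symp R" "irreflp R"
  shows "(\<Sum>Q\<in>clq R V s. card {v\<in>V - Q. \<forall>q\<in>Q. R q v}) = Suc s * card (clq R V (Suc s))"
proof -
  have "bij_betw (\<lambda>(Q, v). (insert v Q, v)) (SIGMA Q:clq R V s. {v\<in>V - Q. \<forall>q\<in>Q. R q v}) (SIGMA K:clq R V (Suc s). K)"
  proof (rule bij_betw_byWitness[where f' = "\<lambda>(K, v). (K - {v}, v)"])
    show "(\<lambda>(Q, v). (insert v Q, v)) ` (SIGMA Q:clq R V s. {v\<in>V - Q. \<forall>q\<in>Q. R q v}) \<subseteq> (SIGMA K:clq R V (Suc s). K)"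
      using clq_insert[OF _ assms(2)] sympD[OF assms(2)] by auto
    show "(\<lambda>(K, v). (K - {v}, v)) ` (SIGMA K:clq R V (Suc s). K) \<subseteq> (SIGMA Q:clq R V s. {v\<in>V - Q. \<forall>q\<in>Q. R q v})"
    proof (rule image_subsetI)
      fix a assume "a \<in> (SIGMA K:clq R V (Suc s). K)"
      then obtain K v where a: "a = (K, v)" and K: "K \<in> clq R V (Suc s)" "v \<in> K" by blast
      then have "\<forall>q\<in>K - {v}. R q v" by (auto simp: clq_iff pairwise_def)
      moreover have "K - {v} \<in> clq R V s" using K by (auto simp: clq_iff pairwise_def)
      moreover have "v \<in> V" using K by (auto simp: clq_iff)
      ultimately show "(\<lambda>(K, v). (K - {v}, v)) a \<in> (SIGMA Q:clq R V s. {v\<in>V - Q. \<forall>q\<in>Q. R q v})"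
        unfolding a by simp
    qed
  qed auto
  then have "card (SIGMA Q:clq R V s. {v\<in>V - Q. \<forall>q\<in>Q. R q v}) = card (SIGMA K:clq R V (Suc s). K)"
    by (rule bij_betw_same_card)
  moreover have "(\<Sum>K\<in>clq R V (Suc s). card K) = (\<Sum>K\<in>clq R V (Suc s). Suc s)"
    by (rule sum.cong) (auto simp: clq_iff)
  ultimately show ?thesis
    using assms(1) by (simp add: card_SigmaI clq_iff)
qed

text \<open>If v misses the set Z \<subseteq> Q, it has s - |Z| neighbours in Q. For Z empty this is
  one more than s - 1; otherwise the shortfall |Z| - 1 is paid for by triples, because the vertices
  of Z are pairwise adjacent.\<close>

lemma sum_degrees_lower:
  assumes "finite V" "symp R" "irreflp R" "Q \<in> clq R V s" "s > 0"
  shows "(card V - s) * (s - 1) + card {v\<in>V - Q. \<forall>q\<in>Q. R q v}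
    \<le> (\<Sum>v\<in>V - Q. card {x\<in>Q. R x v}) + card {(v, y, z) \<in> nonadj_triples R V. v \<notin> Q \<and> y \<in> Q \<and> z \<in> Q}"
proof -
  have Q: "Q \<subseteq> V" "card Q = s" "pairwise R Q" "finite Q" using assms by (auto simp: clq_iff)
  let ?E = "{v\<in>V - Q. \<forall>q\<in>Q. R q v}" and ?p = "\<lambda>v. {(y, z). y \<in> Q \<and> z \<in> Q \<and> R y z \<and> \<not> R v y \<and> \<not> R v z}"
  have cV: "card (V - Q) = card V - s" using Q assms(1) by (simp add: card_Diff_subset)
  have finp: "finite (?p v)" for v
    by (rule finite_subset[of _ "Q \<times> Q"]) (use Q in auto)
  have "(card V - s) * (s - 1) + card ?E = (\<Sum>v\<in>V - Q. (s - 1) + (if v \<in> ?E then 1 else 0))"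
    using assms(1) cV by (simp add: sum.distrib sum.If_cases Int_def)
  also have "\<dots> \<le> (\<Sum>v\<in>V - Q. card {x\<in>Q. R x v} + card (?p v))"
  proof (rule sum_mono)
    fix v assume v: "v \<in> V - Q"
    let ?Z = "{y\<in>Q. \<not> R y v}"
    have "{x\<in>Q. R x v} \<union> ?Z = Q" "{x\<in>Q. R x v} \<inter> ?Z = {}" by auto
    then have c: "card {x\<in>Q. R x v} + card ?Z = s"
      using Q by (metis card_Un_disjoint finite_Un)
    show "(s - 1) + (if v \<in> ?E then 1 else 0) \<le> card {x\<in>Q. R x v} + card (?p v)"
    proof (cases "?Z = {}")
      case True
      have "card {x\<in>Q. R x v} = s" using c unfolding True by simp
      moreover have "(if v \<in> ?E then 1 else 0) \<le> (1 :: nat)" by simp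
      ultimately show ?thesis using assms(5) by linarith
    next
      case False
      then obtain y where y: "y \<in> ?Z" by blast
      have "{y} \<times> (?Z - {y}) \<subseteq> ?p v"
        using y Q(3) sympD[OF assms(2)] by (auto simp: pairwise_def)
      then have "card ({y} \<times> (?Z - {y})) \<le> card (?p v)" by (rule card_mono[OF finp])
      then have "card ?Z - 1 \<le> card (?p v)" using y Q(4) by (simp add: card_cartesian_product)
      then show ?thesis using c y by auto
    qed
  qed
  also have "\<dots> = (\<Sum>v\<in>V - Q. card {x\<in>Q. R x v}) + card (SIGMA v:V - Q. ?p v)"
    using assms(1) finp by (simp add: sum.distrib card_SigmaI)
  also have "(SIGMA v:V - Q. ?p v) = {(v, y, z) \<in> nonadj_triples R V. v \<notin> Q \<and> y \<in> Q \<and> z \<in> Q}"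
    using Q by (auto simp: nonadj_triples_def)
  finally show ?thesis .
qed

text \<open>A vertex exceeds s - 1 neighbours in Q only if it is adjacent to all of Q, and then by
  one. This direction needs no triples and gives the lower bound on pairs that is applied to the
  Turan graph.\<close>

lemma sum_degrees_upper:
  assumes "finite V" "Q \<in> clq R V s" "s > 0"
  shows "(\<Sum>v\<in>V - Q. card {x\<in>Q. R x v}) \<le> (card V - s) * (s - 1) + card {v\<in>V - Q. \<forall>q\<in>Q. R q v}"
proof -
  have Q: "Q \<subseteq> V" "card Q = s" "finite Q" using assms by (auto simp: clq_iff)
  let ?E = "{v\<in>V - Q. \<forall>q\<in>Q. R q v}"
  have cV: "card (V - Q) = card V - s" using Q assms(1) by (simp add: card_Diff_subset)
  have "(\<Sum>v\<in>V - Q. card {x\<in>Q. R x v}) \<le> (\<Sum>v\<in>V - Q. (s - 1) + (if v \<in> ?E then 1 else 0))"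
  proof (rule sum_mono)
    fix v assume v: "v \<in> V - Q"
    show "card {x\<in>Q. R x v} \<le> (s - 1) + (if v \<in> ?E then 1 else 0)"
    proof (cases "v \<in> ?E")
      case True
      have "card {x\<in>Q. R x v} \<le> card Q" using Q by (intro card_mono) auto
      then show ?thesis using True Q assms(3) by simp
    next
      case False
      then have "{x\<in>Q. R x v} \<subset> Q" using v by auto
      then have "card {x\<in>Q. R x v} < card Q" using Q by (intro psubset_card_mono) auto
      then show ?thesis using Q by simp
    qed
  qed
  also have "\<dots> = (card V - s) * (s - 1) + card ?E"
    using assms(1) cV by (simp add: sum.distrib sum.If_cases Int_def)
  finally show ?thesis .
qed

text \<open>
  The number of edges meeting an \<open>s\<close>-clique if every outside vertex misses exactly one of its vertices.
  Outside vertices adjacent to the whole clique are accounted for by \<open>(s + 1)\<close>-cliques.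
\<close>

definition loss :: "nat \<Rightarrow> nat \<Rightarrow> nat" where
  "loss n s = (s choose 2) + (n - s) * (s - 1)"

text \<open>The triple (v, y, z) is counted only for cliques containing both y and z, at most
  n^(s-2) of them. The extra factor \<open>card V\<close> on the left turns the exponent into s - 1
  and thereby covers s = 1, where s - 2 would truncate and no such clique exists.\<close>

lemma sum_nonadj_triples_le:
  assumes "finite V" "irreflp R"
  shows "card V * (\<Sum>Q\<in>clq R V s. card {(v, y, z) \<in> nonadj_triples R V. v \<notin> Q \<and> y \<in> Q \<and> z \<in> Q})
    \<le> card (nonadj_triples R V) * card V ^ (s - 1)"
proof -
  let ?T = "nonadj_triples R V" and ?n = "card V"
  have finT: "finite ?T" using assms finite_nonadj_triples by blast
  have finC: "finite (clq R V s)" using assms by simp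
  have "(\<Sum>Q\<in>clq R V s. card {(v, y, z) \<in> ?T. v \<notin> Q \<and> y \<in> Q \<and> z \<in> Q})
      \<le> (\<Sum>Q\<in>clq R V s. card {t \<in> ?T. {fst (snd t), snd (snd t)} \<subseteq> Q})"
    using finT by (intro sum_mono card_mono) auto
  also have "\<dots> = (\<Sum>t\<in>?T. card {Q \<in> clq R V s. {fst (snd t), snd (snd t)} \<subseteq> Q})"
    using sum_multicount_gen[OF finC finT, of "\<lambda>Q t. {fst (snd t), snd (snd t)} \<subseteq> Q"
        "\<lambda>t. card {Q \<in> clq R V s. {fst (snd t), snd (snd t)} \<subseteq> Q}"] by simp
  finally have "?n * (\<Sum>Q\<in>clq R V s. card {(v, y, z) \<in> ?T. v \<notin> Q \<and> y \<in> Q \<and> z \<in> Q})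
      \<le> (\<Sum>t\<in>?T. ?n * card {Q \<in> clq R V s. {fst (snd t), snd (snd t)} \<subseteq> Q})"
    by (simp add: sum_distrib_left[symmetric])
  also have "\<dots> \<le> (\<Sum>t\<in>?T. ?n ^ (s - 1))"
  proof (rule sum_mono)
    fix t assume "t \<in> ?T"
    then obtain v y z where t: "t = (v, y, z)" "R y z" by (auto simp: nonadj_triples_def)
    then have "y \<noteq> z" using assms(2) by (auto simp: irreflp_def)
    let ?M = "{Q \<in> [V]\<^bsup>s\<^esup>. {y, z} \<subseteq> Q}"
    have "card {Q \<in> clq R V s. {fst (snd t), snd (snd t)} \<subseteq> Q} \<le> card ?M"
      using assms(1) t by (intro card_mono) (auto simp: finite_imp_finite_nsets clq_iff nsets_def)
    moreover have "?n * card ?M \<le> ?n ^ (s - 1)"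
    proof (cases "s \<ge> 2")
      case True
      have "card ?M \<le> ?n ^ (s - 2)"
        using card_nsets_superset_le[OF assms(1), of "{y, z}" s] \<open>y \<noteq> z\<close> by (simp add: numeral_2_eq_2)
      then have "?n * card ?M \<le> ?n ^ Suc (s - 2)" by simp
      also have "Suc (s - 2) = s - 1" using True by simp
      finally show ?thesis .
    next
      case False
      have "?M = {}"
      proof (rule ccontr)
        assume "?M \<noteq> {}"
        then obtain Q where "finite Q" "card Q = s" "{y, z} \<subseteq> Q" by (auto simp: nsets_def)
        then show False using card_mono[of Q "{y, z}"] \<open>y \<noteq> z\<close> False by simp
      qed
      then show ?thesis by (simp only: card.empty)
    qed
    ultimately show "?n * card {Q \<in> clq R V s. {fst (snd t), snd (snd t)} \<subseteq> Q} \<le> ?n ^ (s - 1)"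
      by (meson le_trans mult_le_mono2)
  qed
  also have "\<dots> = card ?T * ?n ^ (s - 1)" by simp
  finally show ?thesis .
qed

text \<open>For each s-clique Q the edges avoiding Q are all edges minus those meeting Q; this is
  summed over Q. Negative terms stand on the left, so that no subtraction of clique counts can
  truncate.\<close>

lemma card_disjoint_pairs_upper:
  assumes "finite V" "symp R" "irreflp R" "s > 0"
  shows "card (disjoint_pairs R V s) + card (clq R V s) * loss (card V) s + Suc s * card (clq R V (Suc s))
    \<le> card (clq R V s) * card (clq R V 2)
      + (\<Sum>Q\<in>clq R V s. card {(v, y, z) \<in> nonadj_triples R V. v \<notin> Q \<and> y \<in> Q \<and> z \<in> Q})"
proof -
  let ?t = "\<lambda>Q. card {(v, y, z) \<in> nonadj_triples R V. v \<notin> Q \<and> y \<in> Q \<and> z \<in> Q}"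
  have "card (disjoint_pairs R V s) + card (clq R V s) * loss (card V) s + Suc s * card (clq R V (Suc s))
    = (\<Sum>Q\<in>clq R V s. card (clq R (V - Q) 2) + loss (card V) s + card {v\<in>V - Q. \<forall>q\<in>Q. R q v})"
    using card_clique_extensions[OF assms(1-3), of s] card_disjoint_pairs[OF assms(1)]
    by (simp add: sum.distrib)
  also have "\<dots> \<le> (\<Sum>Q\<in>clq R V s. card (clq R V 2) + ?t Q)"
  proof (rule sum_mono)
    fix Q assume "Q \<in> clq R V s"
    from card_edges_split[OF assms(1,2) this] sum_degrees_lower[OF assms(1-3) this assms(4)]
    show "card (clq R (V - Q) 2) + loss (card V) s + card {v\<in>V - Q. \<forall>q\<in>Q. R q v} \<le> card (clq R V 2) + ?t Q"
      unfolding loss_def by linarith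
  qed
  also have "\<dots> = card (clq R V s) * card (clq R V 2) + (\<Sum>Q\<in>clq R V s. ?t Q)"
    by (simp add: sum.distrib)
  finally show ?thesis .
qed

lemma card_disjoint_pairs_lower:
  assumes "finite V" "symp R" "irreflp R" "s > 0"
  shows "card (clq R V s) * card (clq R V 2)
    \<le> card (disjoint_pairs R V s) + card (clq R V s) * loss (card V) s + Suc s * card (clq R V (Suc s))"
proof -
  have "card (clq R V s) * card (clq R V 2) = (\<Sum>Q\<in>clq R V s. card (clq R V 2))" by simp
  also have "\<dots> \<le> (\<Sum>Q\<in>clq R V s. card (clq R (V - Q) 2) + loss (card V) s + card {v\<in>V - Q. \<forall>q\<in>Q. R q v})"
  proof (rule sum_mono)
    fix Q assume "Q \<in> clq R V s"
    from card_edges_split[OF assms(1,2) this] sum_degrees_upper[OF assms(1) this assms(4)]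
    show "card (clq R V 2) \<le> card (clq R (V - Q) 2) + loss (card V) s + card {v\<in>V - Q. \<forall>q\<in>Q. R q v}"
      unfolding loss_def by linarith
  qed
  also have "\<dots> = card (disjoint_pairs R V s) + card (clq R V s) * loss (card V) s + Suc s * card (clq R V (Suc s))"
    using card_clique_extensions[OF assms(1-3), of s] card_disjoint_pairs[OF assms(1)]
    by (simp add: sum.distrib)
  finally show ?thesis .
qed

section \<open>Growth of the clique counts of the Turan graph\<close>

lemma turan_cliques_lower:
  assumes "s \<le> r"
  shows "(n div r) ^ s \<le> turan_cliques r s n"
proof -
  \<comment> \<open>A function g selects the vertex with index \<open>g i\<close> in each of the
    first s residue classes; every class has at least \<open>n div r\<close> vertices below
    n.\<close>
  let ?P = "{..<s} \<rightarrow>\<^sub>E {..<n div r}" and ?F = "\<lambda>g. (\<lambda>i. i + r * g i) ` {..<s}"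
  have md: "(i + r * g i) mod r = i" "(i + r * g i) div r = g i" if "i < s" for g :: "nat \<Rightarrow> nat" and i
    using that assms by auto
  have inj1: "inj_on (\<lambda>i. i + r * g i) {..<s}" for g :: "nat \<Rightarrow> nat"
    by (rule inj_on_inverseI[where g = "\<lambda>x. x mod r"]) (use md in auto)
  have "inj_on ?F ?P"
  proof (rule inj_onI)
    fix g h assume gh: "g \<in> ?P" "h \<in> ?P" "?F g = ?F h"
    have "g i = h i" if "i < s" for i
    proof -
      have "i + r * g i \<in> ?F h" using gh(3) that by blast
      then obtain j where j: "j < s" "i + r * g i = j + r * h j" by auto
      then have "i = j" using md(1)[OF that, of g] md(1)[OF j(1), of h] by simp
      then show ?thesis using md(2)[OF that, of g] md(2)[OF that, of h] j(2) by metis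
    qed
    then show "g = h" using gh by (intro PiE_ext[of g "{..<s}" _ h]) auto
  qed
  moreover have "?F ` ?P \<subseteq> clq (turan_adj r) {..<n} s"
  proof (rule image_subsetI)
    fix g assume g: "g \<in> ?P"
    have "i + r * g i < n" if "i < s" for i
    proof -
      have "Suc (g i) \<le> n div r" using g that by (auto simp: PiE_def Pi_def Suc_le_eq)
      then have "r * Suc (g i) \<le> r * (n div r)" by (rule mult_le_mono2)
      also have "\<dots> \<le> n" by simp
      finally show ?thesis using that assms by simp
    qed
    moreover have "card (?F g) = s" using inj1 by (simp add: card_image)
    moreover have "pairwise (turan_adj r) (?F g)" using md by (auto simp: pairwise_def)
    ultimately show "?F g \<in> clq (turan_adj r) {..<n} s" by (auto simp: clq_iff)
  qed
  ultimately have "card ?P \<le> turan_cliques r s n"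
    unfolding turan_cliques_def by (intro card_inj_on_le[of ?F]) auto
  then show ?thesis by (simp add: card_PiE)
qed

lemma turan_cliques_eventually_large:
  assumes "0 < s" "s \<le> r"
  shows "\<forall>\<^sub>F n in sequentially. D * n ^ (s - 1) \<le> turan_cliques r s n"
proof (rule eventually_sequentiallyI)
  \<comment> \<open>The threshold forces m = \<open>n div r\<close> to be at least D (2r)^(s-1) + 1.
    As m \<ge> 1, also n \<le> 2 r m, and then m^s dominates D n^(s-1).\<close>
  fix n assume n: "r * (D * (2 * r) ^ (s - 1) + 1) \<le> n"
  let ?m = "n div r"
  have r: "r > 0" using assms by simp
  have m: "D * (2 * r) ^ (s - 1) + 1 \<le> ?m"
    using n r by (metis div_le_mono nonzero_mult_div_cancel_left not_gr_zero)
  have "n = r * ?m + n mod r" by simp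
  also have "\<dots> \<le> r * ?m + r * 1" using r by (intro add_left_mono) simp
  also have "\<dots> \<le> r * ?m + r * ?m" using m by (intro add_left_mono mult_le_mono2) simp
  finally have "n \<le> 2 * r * ?m" by simp
  then have "D * n ^ (s - 1) \<le> D * (2 * r * ?m) ^ (s - 1)" by (intro mult_le_mono2 power_mono) auto
  also have "\<dots> = D * (2 * r) ^ (s - 1) * ?m ^ (s - 1)" by (simp add: power_mult_distrib)
  also have "\<dots> \<le> ?m * ?m ^ (s - 1)" using m by (intro mult_right_mono) auto
  also have "\<dots> = ?m ^ s" using assms(1) by (cases s) auto
  also have "\<dots> \<le> turan_cliques r s n" by (rule turan_cliques_lower[OF assms(2)])
  finally show "D * n ^ (s - 1) \<le> turan_cliques r s n" .
qed

text \<open>Let t_j and N_j count the j-cliques of the Turan graph and of the given graph. The gain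
  is t_s t_2 - N_s N_2 \<ge> t_s \<epsilon>. The three summands in \<open>large\<close> are the
  costs per \<epsilon> n^(s-1): missing s-cliques weighted by \<open>loss\<close>, missing r-cliques
  counted r times, and triples.\<close>

lemma disjoint_pairs_le_turan:
  assumes V: "finite V" "symp R" "irreflp R" "clq R V (Suc r) = {}" and s: "r = Suc s" "s > 0"
    and large: "(2 * s\<^sup>2 * (r * 2 ^ r) + r * (r * 2 ^ r) + 14 * r) * card V ^ (s - 1) \<le> turan_cliques r s (card V)"
    and n: "card V > 0"
  shows "card (disjoint_pairs R V s) \<le> card (disjoint_pairs (turan_adj r) {..<card V} s)"
proof -
  let ?n = "card V" and ?N = "\<lambda>j. card (clq R V j)" and ?t = "\<lambda>j. turan_cliques r j (card V)"
    and ?e = "edge_deficit r R V" and ?P = "card (disjoint_pairs R V s)" and ?C = "r * 2 ^ r"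
    and ?L = "\<Sum>Q\<in>clq R V s. card {(v, y, z) \<in> nonadj_triples R V. v \<notin> Q \<and> y \<in> Q \<and> z \<in> Q}"
    and ?T = "card (disjoint_pairs (turan_adj r) {..<card V} s)"
  have r: "r > 0" using s by simp
  have Nt: "?N j \<le> ?t j" for j by (rule zykov[OF V r])
  have e: "?t 2 = ?N 2 + ?e" using Nt[of 2] by (simp add: edge_deficit_def)
  have G: "?P + ?N s * loss ?n s + r * ?N r \<le> ?N s * ?N 2 + ?L"
    using card_disjoint_pairs_upper[OF V(1-3) s(2)] s by simp
  have T: "?t s * ?t 2 \<le> ?T + ?t s * loss ?n s + r * ?t r"
    using card_disjoint_pairs_lower[OF _ symp_turan irreflp_turan s(2), of "{..<?n}" r] s
    by (simp add: turan_cliques_def)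
  have 1: "?t s * loss ?n s \<le> ?N s * loss ?n s + 2 * s\<^sup>2 * ?C * ?n ^ (s - 1) * ?e"
  proof (cases "s = 1")
    case True
    \<comment> \<open>For s = 1 \<open>loss\<close> vanishes, while \<open>clique_deficit\<close>
      starts only at 2-cliques.\<close>
    then show ?thesis by (simp add: loss_def numeral_2_eq_2)
  next
    case False
    then have s2: "2 \<le> s" using s by simp
    have "s choose 2 \<le> s\<^sup>2 * ?n"
      using binomial_le_pow[OF s2] n by (metis le_trans mult.right_neutral mult_le_mono2 Suc_leI One_nat_def)
    moreover have "(?n - s) * (s - 1) \<le> ?n * s\<^sup>2"
      by (intro mult_le_mono) (auto simp: power2_eq_square intro: le_trans[OF diff_le_self])
    ultimately have l: "loss ?n s \<le> 2 * s\<^sup>2 * ?n" by (simp add: loss_def mult_ac)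
    have "?t s * loss ?n s \<le> (?N s + ?C * ?e * ?n ^ (s - 2)) * loss ?n s"
      using clique_deficit[OF V r s2] s by (intro mult_le_mono1) simp
    also have "\<dots> = ?N s * loss ?n s + ?C * ?e * ?n ^ (s - 2) * loss ?n s"
      by (simp add: algebra_simps)
    also have "?C * ?e * ?n ^ (s - 2) * loss ?n s \<le> ?C * ?e * ?n ^ (s - 2) * (2 * s\<^sup>2 * ?n)"
      using l by (rule mult_le_mono2)
    also have "\<dots> = 2 * s\<^sup>2 * ?C * (?n ^ Suc (s - 2)) * ?e" by (simp add: mult_ac)
    also have "Suc (s - 2) = s - 1" using s2 by simp
    finally show ?thesis by simp
  qed
  have 2: "r * ?t r \<le> r * ?N r + r * ?C * ?n ^ (s - 1) * ?e"
  proof -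
    have "?t r \<le> ?N r + ?C * ?e * ?n ^ (r - 2)"
      using clique_deficit[OF V r, of r] s by simp
    also have "r - 2 = s - 1" using s by simp
    finally have "r * ?t r \<le> r * (?N r + ?C * ?e * ?n ^ (s - 1))" by (rule mult_le_mono2)
    then show ?thesis by (simp add: algebra_simps)
  qed
  have "?n * ?L \<le> card (nonadj_triples R V) * ?n ^ (s - 1)"
    by (rule sum_nonadj_triples_le[OF V(1,3)])
  also have "\<dots> \<le> 14 * r * ?e * ?n * ?n ^ (s - 1)"
    using card_nonadj_triples_le[OF V r] by (rule mult_le_mono1)
  finally have "?n * ?L \<le> ?n * (14 * r * ?n ^ (s - 1) * ?e)" by (simp add: mult_ac)
  then have 3: "?L \<le> 14 * r * ?n ^ (s - 1) * ?e" using n by simp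
  have 4: "2 * s\<^sup>2 * ?C * ?n ^ (s - 1) * ?e + r * ?C * ?n ^ (s - 1) * ?e + 14 * r * ?n ^ (s - 1) * ?e \<le> ?t s * ?e"
    using mult_le_mono1[OF large, of ?e] by (simp add: algebra_simps)
  have "?N s * ?N 2 \<le> ?t s * ?N 2" using Nt by (rule mult_le_mono1)
  moreover have "?t s * ?t 2 = ?t s * ?N 2 + ?t s * ?e" using e by (simp add: algebra_simps)
  ultimately show ?thesis using G T 1 2 3 4 by linarith
qed

section \<open>Pairs without a missing matching\<close>

definition missing_matching :: "('a \<Rightarrow> 'a \<Rightarrow> bool) \<Rightarrow> 'a set \<Rightarrow> 'a set \<Rightarrow> bool" where
  "missing_matching R Q e \<longleftrightarrow> (\<exists>q\<in>Q. \<exists>q'\<in>Q. \<exists>u\<in>e. \<exists>v\<in>e. q \<noteq> q' \<and> u \<noteq> v \<and> \<not> R q u \<and> \<not> R q' v)"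

text \<open>The missing edges between Q and e form a bipartite graph; having no two disjoint edges,
  they all share a vertex.\<close>

definition star_pairs :: "('a \<Rightarrow> 'a \<Rightarrow> bool) \<Rightarrow> 'a set \<Rightarrow> nat \<Rightarrow> ('a set \<times> 'a set) set" where
  "star_pairs R V s = {(Q, e) \<in> disjoint_pairs R V s. \<not> missing_matching R Q e}"

lemma disjoint_pairsE:
  assumes "(Q, e) \<in> disjoint_pairs R V s" "symp R"
  obtains u v where "Q \<in> clq R V s" "e = {u, v}" "u \<noteq> v" "u \<in> V - Q" "v \<in> V - Q" "R u v"
proof -
  have Q: "Q \<in> clq R V s" and e: "e \<in> clq R (V - Q) 2" using assms by (auto simp: disjoint_pairs_def)
  then obtain u v where uv: "e = {u, v}" by (auto simp: clq_iff card_2_iff)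
  then have "u \<noteq> v" "u \<in> V - Q" "v \<in> V - Q" "R u v"
    using e assms(2) by (auto simp: pair_in_clq_2)
  then show ?thesis using that Q uv by blast
qed

lemma disjoint_pairs_missing_edge:
  assumes "finite V" "symp R" "clq R V (Suc (Suc s)) = {}" "(Q, e) \<in> disjoint_pairs R V s"
  shows "\<exists>q\<in>Q. \<exists>v\<in>e. \<not> R q v"
proof (rule ccontr)
  assume *: "\<not> (\<exists>q\<in>Q. \<exists>v\<in>e. \<not> R q v)"
  obtain u v where uv: "Q \<in> clq R V s" "e = {u, v}" "u \<noteq> v" "u \<in> V - Q" "v \<in> V - Q" "R u v"
    using disjoint_pairsE[OF assms(4,2)] .
  have "insert u Q \<in> clq R V (Suc s)"
    by (rule clq_insert) (use uv * assms(2) in \<open>auto dest: sympD\<close>)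
  then have "insert v (insert u Q) \<in> clq R V (Suc (Suc s))"
    by (rule clq_insert) (use uv * assms(2) in \<open>auto dest: sympD\<close>)
  then show False using assms(3) by simp
qed

text \<open>
  A pair whose missing edges form a star contains an \<open>(s + 1)\<close>-clique \<open>K\<close> and one more vertex \<open>x\<close>. If \<open>x\<close> lies in
  the edge, the pair is determined by \<open>(K, x)\<close> and a neighbour of \<open>x\<close> in \<open>K\<close>; otherwise \<open>x\<close> misses exactly the two
  ends of the edge, so \<open>x\<close> has only \<open>s - 1\<close> neighbours in \<open>K\<close> and one additional pair is harmless.
\<close>

lemma card_star_pairs_le:
  assumes "finite V" "symp R" "irreflp R" "clq R V (Suc (Suc s)) = {}" "s > 0"
  shows "card (star_pairs R V s) \<le> card (clq R V (Suc s)) * ((card V - Suc s) * s)"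
proof -
  let ?C = "clq R V (Suc s)" and ?d = "\<lambda>K x. card {y\<in>K. R y x}"
  let ?X = "SIGMA K:?C. SIGMA x:V - K. {y\<in>K. R y x}"
  let ?Y = "SIGMA K:?C. {x\<in>V - K. ?d K x = s - 1}"
  let ?f = "\<lambda>(K, x, y). (K - {y}, {x, y})"
  let ?g = "\<lambda>(K, x). (insert x {y\<in>K. R y x}, {y\<in>K. \<not> R y x})"
  have "star_pairs R V s \<subseteq> ?f ` ?X \<union> ?g ` ?Y"
  proof
    fix p assume p: "p \<in> star_pairs R V s"
    then obtain Q e where Qe: "p = (Q, e)" "(Q, e) \<in> disjoint_pairs R V s" "\<not> missing_matching R Q e"
      by (auto simp: star_pairs_def)
    obtain u v where uv: "Q \<in> clq R V s" "e = {u, v}" "u \<noteq> v" "u \<in> V - Q" "v \<in> V - Q" "R u v"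
      using disjoint_pairsE[OF Qe(2) assms(2)] .
    have Ruv: "R v u" using uv assms(2) by (auto dest: sympD)
    have X: "p \<in> ?f ` ?X" if "e = {a, b}" "a \<noteq> b" "a \<in> V - Q" "b \<in> V - Q" "R a b" "\<forall>q\<in>Q. R q a" for a b
    proof -
      have "insert a Q \<in> ?C"
        by (rule clq_insert[OF uv(1) assms(2)]) (use that assms(2) in \<open>auto dest: sympD\<close>)
      then have "(insert a Q, b, a) \<in> ?X" using that by auto
      moreover have "p = ?f (insert a Q, b, a)" using that Qe(1) by auto
      ultimately show ?thesis by (rule rev_image_eqI)
    qed
    show "p \<in> ?f ` ?X \<union> ?g ` ?Y"
    proof (cases "(\<forall>q\<in>Q. R q u) \<or> (\<forall>q\<in>Q. R q v)")
      case True
      then show ?thesis using X[of u v] X[of v u] uv Ruv by (auto simp: insert_commute)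
    next
      case False
      \<comment> \<open>Both ends of the edge have a non-neighbour in Q. Without a missing matching
        these coincide, so the star is centred at q in Q and has both ends of the edge as
        leaves.\<close>
      then obtain q q' where q: "q \<in> Q" "\<not> R q u" "q' \<in> Q" "\<not> R q' v" by blast
      have nm: "a = b" if "a \<in> Q" "b \<in> Q" "\<not> R a u" "\<not> R b v" for a b
        using Qe(3) that uv(2,3) unfolding missing_matching_def by blast
      have only: "R a u" "R a v" if "a \<in> Q" "a \<noteq> q" for a
        using nm[OF that(1) q(3) _ q(4)] nm[OF q(1) that(1) q(2)] nm[OF q(1,3,2,4)] that by blast+
      have qv: "\<not> R q v" using nm[OF q(1,3) q(2,4)] q(4) by simp
      have Q: "Q \<subseteq> V" "card Q = s" "finite Q" "pairwise R Q" using uv(1) by (auto simp: clq_iff)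
      let ?K = "insert v (insert u (Q - {q}))"
      have "Q - {q} \<in> clq R V (s - 1)" using Q q(1) by (auto simp: clq_iff pairwise_def)
      then have "insert u (Q - {q}) \<in> clq R V (Suc (s - 1))"
        by (rule clq_insert) (use uv only assms(2) in \<open>auto dest: sympD\<close>)
      then have "?K \<in> clq R V (Suc (Suc (s - 1)))"
        by (rule clq_insert) (use uv Ruv only assms(2) in \<open>auto dest: sympD\<close>)
      then have K: "?K \<in> ?C" using assms(5) by simp
      have Rq: "R y q" if "y \<in> Q - {q}" for y using that Q(4) q(1) by (auto simp: pairwise_def)
      have nR: "\<not> R u q" "\<not> R v q" using q(2) qv assms(2) by (auto dest: sympD)
      have adj: "{y\<in>?K. R y q} = Q - {q}" and nadj: "{y\<in>?K. \<not> R y q} = {u, v}"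
        using Rq nR by auto
      have "q \<in> V - ?K" using q(1) Q(1) uv by auto
      moreover have "?d ?K q = s - 1" unfolding adj using Q q(1) by simp
      ultimately have "(?K, q) \<in> ?Y" using K by simp
      moreover have "p = ?g (?K, q)"
        unfolding prod.case adj nadj using q(1) Qe(1) uv(2) by (simp add: insert_absorb)
      ultimately have "p \<in> ?g ` ?Y" by (rule rev_image_eqI)
      then show ?thesis by simp
    qed
  qed
  moreover have fin: "finite ?X" "finite ?Y" using assms(1) by (auto simp: clq_iff)
  ultimately have "card (star_pairs R V s) \<le> card (?f ` ?X \<union> ?g ` ?Y)"
    by (intro card_mono) auto
  also have "\<dots> \<le> card ?X + card ?Y"
    by (intro order_trans[OF card_Un_le] add_mono card_image_le fin)
  also have "\<dots> = (\<Sum>K\<in>?C. (\<Sum>x\<in>V - K. ?d K x) + card {x\<in>V - K. ?d K x = s - 1})"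
    using assms(1) by (simp add: card_SigmaI clq_iff sum.distrib)
  also have "\<dots> = (\<Sum>K\<in>?C. \<Sum>x\<in>V - K. ?d K x + (if ?d K x = s - 1 then 1 else 0))"
    using assms(1) by (simp add: sum.distrib sum.If_cases Int_def)
  \<comment> \<open>A vertex outside K has at most s neighbours in K; the extra 1 is added only when
    it has s - 1, so the sum still does not exceed s.\<close>
  also have "\<dots> \<le> (\<Sum>K\<in>?C. \<Sum>x\<in>V - K. s)"
  proof (intro sum_mono)
    fix K x assume K: "K \<in> ?C" and x: "x \<in> V - K"
    have "{x} \<in> clq R (V - K) (Suc 0)" using x by (simp add: clq_1)
    from card_common_neighbours_le[OF assms(1,2,4) K this]
    show "?d K x + (if ?d K x = s - 1 then 1 else 0) \<le> s" using assms(5) by auto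
  qed
  also have "\<dots> = (\<Sum>K\<in>?C. (card V - Suc s) * s)"
    by (rule sum.cong) (use assms(1) in \<open>auto simp: clq_iff card_Diff_subset\<close>)
  finally show ?thesis by simp
qed

text \<open>Here every outside vertex has exactly s neighbours in an (s+1)-clique K, so the triples
  (K, x, y) with y a neighbour of x in K attain the estimate of \<open>card_star_pairs_le\<close>.
  In the pair (K - {y}, {x, y}) all missing edges end in x.\<close>

lemma card_star_pairs_turan:
  "turan_cliques (Suc s) (Suc s) n * ((n - Suc s) * s) \<le> card (star_pairs (turan_adj (Suc s)) {..<n} s)"
proof -
  let ?r = "Suc s" and ?R = "turan_adj (Suc s)" and ?V = "{..<n}"
  let ?C = "clq ?R ?V ?r"
  let ?X = "SIGMA K:?C. SIGMA x:?V - K. {y\<in>K. ?R y x}"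
  let ?f = "\<lambda>(K, x, y). (K - {y}, {x, y})"
  have "inj_on ?f ?X"
  proof (rule inj_onI)
    fix a b assume ab: "a \<in> ?X" "b \<in> ?X" "?f a = ?f b"
    obtain K x y where a: "a = (K, x, y)" by (metis prod_cases3)
    obtain K' x' y' where b: "b = (K', x', y')" by (metis prod_cases3)
    have A: "K \<in> ?C" "x \<in> ?V" "x \<notin> K" "y \<in> K" "?R y x" using ab(1) a by auto
    have B: "K' \<in> ?C" "x' \<in> ?V" "x' \<notin> K'" "y' \<in> K'" "?R y' x'" using ab(2) b by auto
    have eq: "K - {y} = K' - {y'}" "{x, y} = {x', y'}" using ab(3) a b by auto
    show "a = b"
    proof (cases "y = y'")
      case True
      then show ?thesis using eq A B a b by (auto simp: doubleton_eq_iff)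
    next
      case False
      \<comment> \<open>The two ends of the edge would have exchanged roles. Then x is adjacent to
        all of K, which creates a clique with more vertices than there are classes.\<close>
      then have "x = y'" "y = x'" using eq(2) by (auto simp: doubleton_eq_iff)
      have "?R x q" if "q \<in> K" for q
      proof (cases "q = y")
        case True
        then show ?thesis using A by auto
      next
        case False
        then have "q \<in> K'" "q \<noteq> y'" using that eq(1) by auto
        then show ?thesis using B(1,4) \<open>x = y'\<close> by (auto simp: clq_iff pairwise_def)
      qed
      then have "insert x K \<in> clq ?R ?V (Suc ?r)"
        using clq_insert[OF A(1) symp_turan A(2,3)] by blast
      then show ?thesis using turan_clique_free[of ?r ?V] by simp
    qed
  qed
  moreover have "?f ` ?X \<subseteq> star_pairs ?R ?V s"
  proof (rule image_subsetI)
    fix a assume "a \<in> ?X"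
    then obtain K x y where a: "a = (K, x, y)" and A: "K \<in> ?C" "x \<in> ?V" "x \<notin> K" "y \<in> K" "?R y x" by auto
    have "K - {y} \<in> clq ?R ?V s" using A by (auto simp: clq_iff pairwise_def)
    moreover have "{x, y} \<in> clq ?R (?V - (K - {y})) 2"
      using A by (subst pair_in_clq_2[OF symp_turan]) (auto simp: clq_iff)
    moreover have "\<not> missing_matching ?R (K - {y}) {x, y}"
      using A by (auto simp: missing_matching_def clq_iff pairwise_def)
    ultimately show "?f a \<in> star_pairs ?R ?V s"
      unfolding a by (simp add: star_pairs_def disjoint_pairs_def)
  qed
  moreover have "finite (star_pairs ?R ?V s)"
    by (rule finite_subset[OF _ finite_disjoint_pairs[of ?V ?R s]]) (auto simp: star_pairs_def)
  ultimately have "card ?X \<le> card (star_pairs ?R ?V s)"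
    by (rule card_inj_on_le)
  moreover have "card ?X = (\<Sum>K\<in>?C. \<Sum>x\<in>?V - K. card {y\<in>K. ?R y x})"
    by (simp add: card_SigmaI clq_iff)
  moreover have "\<dots> = (\<Sum>K\<in>?C. \<Sum>x\<in>?V - K. s)"
  proof (intro sum.cong refl)
    fix K x assume K: "K \<in> ?C" and x: "x \<in> ?V - K"
    have "{x} \<in> clq ?R ?V (Suc 0)" using x by (simp add: clq_1)
    from card_turan_common_neighbours[OF _ K this] show "card {y\<in>K. ?R y x} = s" by simp
  qed
  moreover have "\<dots> = (\<Sum>K\<in>?C. (n - ?r) * s)"
    by (rule sum.cong) (auto simp: clq_iff card_Diff_subset)
  ultimately show ?thesis by (simp add: turan_cliques_def)
qed

section \<open>Copies and embeddings\<close>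

definition adj :: "'a ugraph \<Rightarrow> 'a \<Rightarrow> 'a \<Rightarrow> bool" where
  "adj G x y \<longleftrightarrow> {x, y} \<in> edges G"

lemma symp_adj: "symp (adj G)"
  by (auto simp: symp_def adj_def insert_commute)

lemma irreflp_adj: "simple_graph G \<Longrightarrow> irreflp (adj G)"
  by (auto simp: irreflp_def adj_def simple_graph_def nsets_def)

text \<open>Functions are extensional, so that maps agreeing on the vertices of H are counted once
  and the set is finite for finite graphs.\<close>

definition isos :: "'b ugraph \<Rightarrow> 'a ugraph \<Rightarrow> ('b \<Rightarrow> 'a) set" where
  "isos H S = {f \<in> verts H \<rightarrow>\<^sub>E verts S. bij_betw f (verts H) (verts S) \<and> (`) f ` edges H = edges S}"

definition embeddings :: "'b ugraph \<Rightarrow> 'a ugraph \<Rightarrow> ('b \<Rightarrow> 'a) set" where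
  "embeddings H G = {f \<in> verts H \<rightarrow>\<^sub>E verts G. inj_on f (verts H) \<and> (`) f ` edges H \<subseteq> edges G}"

lemma edges_subset_verts: "simple_graph G \<Longrightarrow> e \<in> edges G \<Longrightarrow> e \<subseteq> verts G"
  by (auto simp: simple_graph_def nsets_def)

text \<open>Composition with a fixed isomorphism from S to H is a bijection onto the automorphisms
  of H.\<close>

lemma card_isos:
  assumes "simple_graph H" "simple_graph S" "graph_iso S H"
  shows "card (isos H S) = card (isos H H)"
proof -
  obtain g where g: "bij_betw g (verts S) (verts H)" "(`) g ` edges S = edges H"
    using assms(3) by (auto simp: graph_iso_def)
  let ?h = "the_inv_into (verts S) g"
  have h: "bij_betw ?h (verts H) (verts S)" using g(1) by (rule bij_betw_the_inv_into)
  have gh: "g (?h y) = y" if "y \<in> verts H" for y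
    using g(1) that by (simp add: bij_betw_def f_the_inv_into_f)
  have hg: "?h (g x) = x" if "x \<in> verts S" for x
    using g(1) that by (simp add: bij_betw_def the_inv_into_f_f)
  have "(`) ?h ` edges H = (`) ?h ` (`) g ` edges S" using g(2) by simp
  also have "\<dots> = edges S"
  proof -
    have "?h ` g ` e = e" if "e \<in> edges S" for e
      using hg edges_subset_verts[OF assms(2) that] by (force simp: image_image)
    then show ?thesis by (simp add: image_image)
  qed
  finally have hE: "(`) ?h ` edges H = edges S" .
  have trans: "restrict (\<phi> \<circ> f) (verts H) \<in> isos H Z"
    if "f \<in> isos H Y" "bij_betw \<phi> (verts Y) (verts Z)" "(`) \<phi> ` edges Y = edges Z"
    for f \<phi> and Y :: "'c ugraph" and Z :: "'d ugraph"
  proof -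
    have f: "bij_betw f (verts H) (verts Y)" "(`) f ` edges H = edges Y"
      using that(1) by (auto simp: isos_def)
    have b: "bij_betw (restrict (\<phi> \<circ> f) (verts H)) (verts H) (verts Z)"
      using bij_betw_trans[OF f(1) that(2)] by (simp add: bij_betw_restrict_eq)
    have "restrict (\<phi> \<circ> f) (verts H) ` e = \<phi> ` f ` e" if "e \<in> edges H" for e
      using edges_subset_verts[OF assms(1) that] by (force simp: image_def)
    then have "(`) (restrict (\<phi> \<circ> f) (verts H)) ` edges H = (`) \<phi> ` (`) f ` edges H"
      by (simp add: image_image)
    then show ?thesis using b f(2) that(3) by (auto simp: isos_def bij_betw_def)
  qed
  have "bij_betw (\<lambda>f. restrict (g \<circ> f) (verts H)) (isos H S) (isos H H)"
  proof (rule bij_betw_byWitness[where f' = "\<lambda>f. restrict (?h \<circ> f) (verts H)"])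
    show "\<forall>f\<in>isos H S. restrict (?h \<circ> restrict (g \<circ> f) (verts H)) (verts H) = f"
      using hg by (auto simp: isos_def fun_eq_iff restrict_def PiE_def extensional_def bij_betw_def)
    show "\<forall>f\<in>isos H H. restrict (g \<circ> restrict (?h \<circ> f) (verts H)) (verts H) = f"
      using gh by (auto simp: isos_def fun_eq_iff restrict_def PiE_def extensional_def bij_betw_def)
    show "(\<lambda>f. restrict (g \<circ> f) (verts H)) ` isos H S \<subseteq> isos H H"
      using trans[OF _ g] by blast
    show "(\<lambda>f. restrict (?h \<circ> f) (verts H)) ` isos H H \<subseteq> isos H S"
      using trans[OF _ h hE] by blast
  qed
  then show ?thesis by (rule bij_betw_same_card)
qed

lemma finite_copies: "simple_graph G \<Longrightarrow> finite (copies H G)"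
proof -
  assume G: "simple_graph G"
  have "copies H G \<subseteq> (\<lambda>(V, E). Graph V E) ` (Pow (verts G) \<times> Pow (edges G))"
  proof
    fix S assume "S \<in> copies H G"
    then show "S \<in> (\<lambda>(V, E). Graph V E) ` (Pow (verts G) \<times> Pow (edges G))"
      by (intro image_eqI[of _ _ "(verts S, edges S)"]) (auto simp: copies_def subgraph_def)
  qed
  moreover have "finite (edges G)"
    using G finite_subset[OF _ finite_imp_finite_nsets] by (auto simp: simple_graph_def)
  ultimately show ?thesis
    using G finite_subset by (fastforce simp: simple_graph_def)
qed

text \<open>An embedding determines the copy that is its image, and the embeddings with image S are
  the isomorphisms from H to S, equally many for every copy.\<close>

lemma card_embeddings:
  assumes "simple_graph H" "simple_graph G"
  shows "card (embeddings H G) = card (isos H H) * num_copies H G"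
proof -
  let ?F = "\<lambda>f. Graph (f ` verts H) ((`) f ` edges H)"
  have finE: "finite (embeddings H G)"
    using assms by (intro finite_subset[OF _ finite_PiE[of "verts H" "\<lambda>_. verts G"]])
      (auto simp: embeddings_def simple_graph_def)
  have sub: "?F ` embeddings H G \<subseteq> copies H G"
  proof (rule image_subsetI)
    fix f assume f: "f \<in> embeddings H G"
    let ?S = "?F f"
    have inj: "inj_on f (verts H)" using f by (simp add: embeddings_def)
    have "(`) f ` edges H \<subseteq> [f ` verts H]\<^bsup>2\<^esup>"
    proof (rule image_subsetI)
      fix e assume e: "e \<in> edges H"
      then have "e \<subseteq> verts H" by (rule edges_subset_verts[OF assms(1)])
      then have "card (f ` e) = card e" using inj by (meson card_image inj_on_subset)
      then show "f ` e \<in> [f ` verts H]\<^bsup>2\<^esup>"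
        using e assms(1) by (auto simp: simple_graph_def nsets_def)
    qed
    then have S: "simple_graph ?S" using assms(1) by (simp add: simple_graph_def)
    let ?h = "the_inv_into (verts H) f"
    have "?h ` f ` e = e" if "e \<in> edges H" for e
      using inj edges_subset_verts[OF assms(1) that] by (force simp: image_image the_inv_into_f_f)
    then have "(`) ?h ` edges ?S = edges H" by (simp add: image_image)
    moreover have "bij_betw ?h (verts ?S) (verts H)"
      using inj by (simp add: bij_betw_the_inv_into inj_on_imp_bij_betw)
    ultimately have "graph_iso ?S H" by (auto simp: graph_iso_def)
    then show "?S \<in> copies H G"
      using S f by (auto simp: copies_def subgraph_def embeddings_def)
  qed
  have "card (embeddings H G) = (\<Sum>S\<in>copies H G. \<Sum>f\<in>{f \<in> embeddings H G. ?F f = S}. 1)"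
    by (subst sum.group[OF finE finite_copies[OF assms(2)] sub]) simp
  also have "\<dots> = (\<Sum>S\<in>copies H G. card (isos H H))"
  proof (rule sum.cong)
    fix S assume S: "S \<in> copies H G"
    then have S': "simple_graph S" "graph_iso S H" "verts S \<subseteq> verts G" "edges S \<subseteq> edges G"
      by (auto simp: copies_def subgraph_def)
    have "{f \<in> embeddings H G. ?F f = S} = isos H S"
      using S'(3,4) by (cases S) (fastforce simp: embeddings_def isos_def bij_betw_def)
    then show "(\<Sum>f\<in>{f \<in> embeddings H G. ?F f = S}. 1) = card (isos H H)"
      using card_isos[OF assms(1) S'(1,2)] by simp
  qed simp
  finally show ?thesis by (simp add: num_copies_def)
qed

text \<open>The number of automorphisms is positive because of the identity, so it can be
  cancelled.\<close>

lemma num_copies_le: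
  assumes "simple_graph H" "simple_graph G" "simple_graph G'"
    "card (embeddings H G) \<le> card (embeddings H G')"
  shows "num_copies H G \<le> num_copies H G'"
proof -
  have "restrict id (verts H) \<in> isos H H"
  proof -
    have "restrict id (verts H) ` e = e" if "e \<in> edges H" for e
      using edges_subset_verts[OF assms(1) that] by force
    then show ?thesis by (auto simp: isos_def bij_betw_def inj_on_def)
  qed
  moreover have "finite (isos H H)"
    using assms(1) by (intro finite_subset[OF _ finite_PiE[of "verts H" "\<lambda>_. verts H"]])
      (auto simp: isos_def simple_graph_def)
  ultimately have "card (isos H H) > 0" by (auto simp: card_gt_0_iff)
  then show ?thesis using assms by (simp add: card_embeddings)
qed

lemma graph_free_complete_iff:
  assumes "simple_graph G"
  shows "graph_free (complete_graph k) G \<longleftrightarrow> clq (adj G) (verts G) k = {}"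
proof
  assume free: "graph_free (complete_graph k) G"
  show "clq (adj G) (verts G) k = {}"
  proof (rule ccontr)
    assume "clq (adj G) (verts G) k \<noteq> {}"
    then obtain Q where "Q \<in> clq (adj G) (verts G) k" by blast
    then have Q: "Q \<subseteq> verts G" "finite Q" "card Q = k" "pairwise (adj G) Q"
      unfolding clq_iff by blast+
    obtain h where h: "bij_betw h Q {..<k}"
      using finite_same_card_bij[of Q "{..<k}"] Q by auto
    have "(`) h ` [Q]\<^bsup>2\<^esup> = [{..<k}]\<^bsup>2\<^esup>"
      using bij_betw_nsets[OF h, of 2] by (simp add: bij_betw_def)
    then have "graph_iso (Graph Q ([Q]\<^bsup>2\<^esup>)) (complete_graph k)"
      using h by (auto simp: graph_iso_def complete_graph_def)
    moreover have "[Q]\<^bsup>2\<^esup> \<subseteq> edges G"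
      using Q(4) by (auto simp: nsets_def card_2_iff pairwise_def adj_def)
    ultimately have "Graph Q ([Q]\<^bsup>2\<^esup>) \<in> copies (complete_graph k) G"
      using Q by (auto simp: copies_def subgraph_def simple_graph_def)
    then show False using free by (simp add: graph_free_def)
  qed
next
  assume clq: "clq (adj G) (verts G) k = {}"
  show "graph_free (complete_graph k) G"
  proof (rule ccontr)
    assume "\<not> graph_free (complete_graph k) G"
    then obtain S f where S: "simple_graph S" "verts S \<subseteq> verts G" "edges S \<subseteq> edges G"
      and f: "bij_betw f (verts S) {..<k}" "(`) f ` edges S = [{..<k}]\<^bsup>2\<^esup>"
      by (auto simp: graph_free_def copies_def subgraph_def graph_iso_def complete_graph_def)
    have inj: "inj_on f (verts S)" using f(1) by (simp add: bij_betw_def)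
    have "adj G x y" if xy: "x \<in> verts S" "y \<in> verts S" "x \<noteq> y" for x y
    proof -
      have "f x \<noteq> f y" using inj xy by (auto dest: inj_onD)
      then have "f ` {x, y} \<in> [{..<k}]\<^bsup>2\<^esup>"
        using xy f(1) by (auto simp: nsets_def bij_betw_def)
      then obtain e where e: "e \<in> edges S" "f ` e = f ` {x, y}" using f(2) by (metis imageE)
      have "e = {x, y}"
        using inj_on_image_eq_iff[OF inj edges_subset_verts[OF S(1) e(1)], of "{x, y}"] e(2) xy by simp
      then show ?thesis using e S(3) by (auto simp: adj_def)
    qed
    then have "verts S \<in> clq (adj G) (verts G) k"
      using S f(1) bij_betw_same_card[OF f(1)] by (auto simp: clq_iff pairwise_def simple_graph_def)
    then show False using clq by simp
  qed
qed

section \<open>Embeddings with prescribed parts\<close>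

text \<open>Intended for cliques Q and e: edges inside A and inside B are then preserved
  automatically, and only the cross edges in M have to be tested.\<close>

definition part_maps :: "'b set \<Rightarrow> 'b set \<Rightarrow> 'b set set \<Rightarrow> ('a \<Rightarrow> 'a \<Rightarrow> bool) \<Rightarrow> 'a set \<Rightarrow> 'a set \<Rightarrow> ('b \<Rightarrow> 'a) set" where
  "part_maps A B M R Q e = {f \<in> A \<union> B \<rightarrow>\<^sub>E Q \<union> e. bij_betw f A Q \<and> bij_betw f B e \<and>
     (\<forall>a\<in>A. \<forall>b\<in>B. {a, b} \<in> M \<longrightarrow> R (f a) (f b))}"

lemma finite_part_maps: "finite A \<Longrightarrow> finite B \<Longrightarrow> finite Q \<Longrightarrow> finite e \<Longrightarrow> finite (part_maps A B M R Q e)"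
  by (rule finite_subset[OF _ finite_PiE[of "A \<union> B" "\<lambda>_. Q \<union> e"]]) (auto simp: part_maps_def)

text \<open>Composition with g is injective, and it respects M because g carries adjacent cross
  pairs to adjacent cross pairs.\<close>

lemma card_part_maps_le:
  assumes fin: "finite A" "finite B" "finite Q'" "finite e'"
    and g: "bij_betw g Q Q'" "bij_betw g e e'"
    and R: "\<And>q v. q \<in> Q \<Longrightarrow> v \<in> e \<Longrightarrow> R q v \<Longrightarrow> R' (g q) (g v)"
  shows "card (part_maps A B M R Q e) \<le> card (part_maps A B M R' Q' e')"
proof (rule card_inj_on_le)
  let ?\<Phi> = "\<lambda>f. restrict (g \<circ> f) (A \<union> B)"
  show "finite (part_maps A B M R' Q' e')" using fin by (rule finite_part_maps)
  show "inj_on ?\<Phi> (part_maps A B M R Q e)"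
  proof (rule inj_onI)
    fix f h assume *: "f \<in> part_maps A B M R Q e" "h \<in> part_maps A B M R Q e" "?\<Phi> f = ?\<Phi> h"
    have eq: "g (f x) = g (h x)" if "x \<in> A \<union> B" for x
      using fun_cong[OF *(3), of x] that by simp
    have "f x = h x" if x: "x \<in> A \<union> B" for x
    proof (cases "x \<in> A")
      case True
      then have "f x \<in> Q" "h x \<in> Q" using *(1,2) by (auto simp: part_maps_def bij_betw_def)
      then show ?thesis using eq[OF x] g(1) by (auto simp: bij_betw_def dest: inj_onD)
    next
      case False
      then have "f x \<in> e" "h x \<in> e" using *(1,2) x by (auto simp: part_maps_def bij_betw_def)
      then show ?thesis using eq[OF x] g(2) by (auto simp: bij_betw_def dest: inj_onD)
    qed
    then show "f = h"
      using *(1,2) by (intro PiE_ext[of f "A \<union> B" "\<lambda>_. Q \<union> e" h]) (auto simp: part_maps_def)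
  qed
  show "?\<Phi> ` part_maps A B M R Q e \<subseteq> part_maps A B M R' Q' e'"
  proof (rule image_subsetI)
    fix f assume f: "f \<in> part_maps A B M R Q e"
    then have b: "bij_betw f A Q" "bij_betw f B e" by (auto simp: part_maps_def)
    have "bij_betw (g \<circ> f) A Q'" "bij_betw (g \<circ> f) B e'"
      using bij_betw_trans[OF b(1) g(1)] bij_betw_trans[OF b(2) g(2)] by auto
    then have 1: "bij_betw (?\<Phi> f) A Q'" "bij_betw (?\<Phi> f) B e'"
      by (auto intro: bij_betw_cong[THEN iffD1, rotated])
    moreover have "R' (?\<Phi> f a) (?\<Phi> f b)" if "a \<in> A" "b \<in> B" "{a, b} \<in> M" for a b
    proof -
      have "f a \<in> Q" "f b \<in> e" using b that by (auto simp: bij_betw_def)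
      moreover have "R (f a) (f b)" using f that by (auto simp: part_maps_def)
      ultimately show ?thesis using R that by simp
    qed
    moreover have "?\<Phi> f \<in> A \<union> B \<rightarrow>\<^sub>E Q' \<union> e'"
      using 1 by (auto simp: bij_betw_def PiE_def Pi_def)
    ultimately show "?\<Phi> f \<in> part_maps A B M R' Q' e'" by (auto simp: part_maps_def)
  qed
qed

lemma obtain_bij_betw_two:
  assumes "finite A" "finite Q" "card A = card Q" "a \<in> A" "a' \<in> A" "q \<in> Q" "q' \<in> Q" "a = a' \<longleftrightarrow> q = q'"
  obtains g where "bij_betw g A Q" "g a = q" "g a' = q'"
proof -
  have "card (A - {a, a'}) = card (Q - {q, q'})"
    using assms by (simp add: card_Diff_subset card_insert_if)
  then obtain h where h: "bij_betw h (A - {a, a'}) (Q - {q, q'})"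
    using finite_same_card_bij[of "A - {a, a'}" "Q - {q, q'}"] assms by auto
  let ?g = "h(a := q, a' := q')"
  have "bij_betw ?g (A - {a, a'}) (Q - {q, q'})"
    using h by (rule bij_betw_cong[THEN iffD1, rotated]) auto
  moreover have "bij_betw ?g {a, a'} {q, q'}"
    using assms(8) by (auto simp: bij_betw_def)
  ultimately have "bij_betw ?g ((A - {a, a'}) \<union> {a, a'}) ((Q - {q, q'}) \<union> {q, q'})"
    by (rule bij_betw_combine) auto
  moreover have "(A - {a, a'}) \<union> {a, a'} = A" "(Q - {q, q'}) \<union> {q, q'} = Q" using assms by auto
  ultimately have "bij_betw ?g A Q" by simp
  then show ?thesis using that[of ?g] assms(8) by auto
qed

lemma card_part_maps_two_missing_le:
  assumes fin: "finite A" "finite B" "finite Q'" "finite e'" "finite Q" "finite e"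
    and card: "card Q = card Q'" "card e = card e'"
    and disj: "Q \<inter> e = {}"
    and mem: "q \<in> Q" "q' \<in> Q" "v \<in> e" "v' \<in> e" "x \<in> Q'" "x' \<in> Q'" "y \<in> e'" "y' \<in> e'"
    and eq: "q = q' \<longleftrightarrow> x = x'" "v = v' \<longleftrightarrow> y = y'"
    and R: "\<not> R q v" "\<not> R q' v'"
    and R': "\<And>a b. a \<in> Q' \<Longrightarrow> b \<in> e' \<Longrightarrow> \<not> R' a b \<Longrightarrow> a = x \<and> b = y \<or> a = x' \<and> b = y'"
  shows "card (part_maps A B M R Q e) \<le> card (part_maps A B M R' Q' e')"
proof -
  obtain g1 where g1: "bij_betw g1 Q Q'" "g1 q = x" "g1 q' = x'"
    using obtain_bij_betw_two[of Q Q' q q' x x'] fin card mem eq by blast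
  obtain g2 where g2: "bij_betw g2 e e'" "g2 v = y" "g2 v' = y'"
    using obtain_bij_betw_two[of e e' v v' y y'] fin card mem eq by blast
  let ?g = "\<lambda>z. if z \<in> Q then g1 z else g2 z"
  have ge: "?g z = g2 z" if "z \<in> e" for z using that disj by auto
  have b: "bij_betw ?g Q Q'" "bij_betw ?g e e'"
    using g1(1) g2(1) ge by (auto intro: bij_betw_cong[THEN iffD1, rotated])
  show ?thesis
  proof (rule card_part_maps_le[OF fin(1-4) b])
    fix a c assume ac: "a \<in> Q" "c \<in> e" "R a c"
    have inj: "a = q" if "g1 a = x" using g1 mem ac that by (auto simp: bij_betw_def dest: inj_onD)
    have inj': "a = q'" if "g1 a = x'" using g1 mem ac that by (auto simp: bij_betw_def dest: inj_onD)
    have inj2: "c = v" if "g2 c = y" using g2 mem ac that by (auto simp: bij_betw_def dest: inj_onD)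
    have inj2': "c = v'" if "g2 c = y'" using g2 mem ac that by (auto simp: bij_betw_def dest: inj_onD)
    have "g1 a \<in> Q'" "g2 c \<in> e'" using g1(1) g2(1) ac by (auto simp: bij_betw_def)
    then have "R' (g1 a) (g2 c)"
      using R'[of "g1 a" "g2 c"] inj inj' inj2 inj2' R ac(3) by blast
    then show "R' (?g a) (?g c)" using ac ge by simp
  qed
qed

text \<open>A and B are cliques of H, so an embedding maps them onto a disjoint clique and edge;
  conversely the edges inside the two parts are preserved because Q and e are cliques.\<close>

lemma embeddings_eq_Union:
  assumes A: "finite A" "finite B" "card B = 2" "A \<inter> B = {}" "M \<subseteq> {{a, b} | a b. a \<in> A \<and> b \<in> B}"
    and H: "H = Graph (A \<union> B) ([A]\<^bsup>2\<^esup> \<union> [B]\<^bsup>2\<^esup> \<union> M)"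
  shows "embeddings H G = (\<Union>(Q, e)\<in>disjoint_pairs (adj G) (verts G) (card A). part_maps A B M (adj G) Q e)"
proof (intro set_eqI iffI)
  fix f assume f: "f \<in> embeddings H G"
  have inj: "inj_on f (A \<union> B)" and ran: "f \<in> A \<union> B \<rightarrow>\<^sub>E verts G"
    and E: "\<And>e. e \<in> [A]\<^bsup>2\<^esup> \<union> [B]\<^bsup>2\<^esup> \<union> M \<Longrightarrow> f ` e \<in> edges G"
    using f H by (auto simp: embeddings_def)
  have injA: "inj_on f A" and injB: "inj_on f B" using inj by (auto intro: inj_on_subset)
  have pw: "pairwise (adj G) (f ` C)" if "[C]\<^bsup>2\<^esup> \<subseteq> [A]\<^bsup>2\<^esup> \<union> [B]\<^bsup>2\<^esup>" for C
  proof -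
    have "adj G (f x) (f y)" if "x \<in> C" "y \<in> C" "f x \<noteq> f y" for x y
    proof -
      have "{x, y} \<in> [C]\<^bsup>2\<^esup>" using that by auto
      then have "{x, y} \<in> [A]\<^bsup>2\<^esup> \<union> [B]\<^bsup>2\<^esup> \<union> M" using \<open>[C]\<^bsup>2\<^esup> \<subseteq> _\<close> by blast
      from E[OF this] show ?thesis by (simp add: adj_def)
    qed
    then show ?thesis by (auto simp: pairwise_def)
  qed
  have "f ` A \<in> clq (adj G) (verts G) (card A)"
    using pw[of A] ran A(1) card_image[OF injA] by (auto simp: clq_iff)
  moreover have "f ` A \<inter> f ` B = {}"
    using inj A(4) by (metis image_empty inj_on_image_Int sup_ge1 sup_ge2)
  then have "f ` B \<in> clq (adj G) (verts G - f ` A) 2"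
    using pw[of B] ran A(2,3) card_image[OF injB] by (auto simp: clq_iff)
  ultimately have "(f ` A, f ` B) \<in> disjoint_pairs (adj G) (verts G) (card A)"
    by (simp add: disjoint_pairs_def)
  moreover have "adj G (f a) (f b)" if "{a, b} \<in> M" for a b
    using E[of "{a, b}"] that by (simp add: adj_def)
  then have "f \<in> part_maps A B M (adj G) (f ` A) (f ` B)"
    using ran injA injB by (auto simp: part_maps_def bij_betw_def PiE_def)
  ultimately show "f \<in> (\<Union>(Q, e)\<in>disjoint_pairs (adj G) (verts G) (card A). part_maps A B M (adj G) Q e)"
    by blast
next
  fix f assume "f \<in> (\<Union>(Q, e)\<in>disjoint_pairs (adj G) (verts G) (card A). part_maps A B M (adj G) Q e)"
  then obtain Q e where Qe: "Q \<in> clq (adj G) (verts G) (card A)" "e \<in> clq (adj G) (verts G - Q) 2"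
    and f: "f \<in> A \<union> B \<rightarrow>\<^sub>E Q \<union> e" "bij_betw f A Q" "bij_betw f B e"
      "\<And>a b. a \<in> A \<Longrightarrow> b \<in> B \<Longrightarrow> {a, b} \<in> M \<Longrightarrow> adj G (f a) (f b)"
    by (auto simp: disjoint_pairs_def part_maps_def)
  have Qe': "Q \<subseteq> verts G" "e \<subseteq> verts G" "Q \<inter> e = {}" "pairwise (adj G) Q" "pairwise (adj G) e"
    using Qe by (auto simp: clq_iff)
  have "bij_betw f (A \<union> B) (Q \<union> e)" by (rule bij_betw_combine[OF f(2,3) Qe'(3)])
  then have inj: "inj_on f (A \<union> B)" by (simp add: bij_betw_def)
  have edge: "f ` {x, y} \<in> edges G" if "adj G (f x) (f y)" for x y
    using that by (simp add: adj_def)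
  have "f ` d \<in> edges G" if d: "d \<in> [A]\<^bsup>2\<^esup> \<union> [B]\<^bsup>2\<^esup> \<union> M" for d
  proof -
    consider x y where "d = {x, y}" "x \<in> A" "y \<in> A" "x \<noteq> y" | x y where "d = {x, y}" "x \<in> B" "y \<in> B" "x \<noteq> y"
      | a b where "d = {a, b}" "a \<in> A" "b \<in> B" "{a, b} \<in> M"
      using d A(5) by (auto elim!: nsets2_E)
    then show ?thesis
    proof cases
      case 1
      then have "f x \<in> Q" "f y \<in> Q" "f x \<noteq> f y" using f(2) by (auto simp: bij_betw_def dest: inj_onD)
      then show ?thesis using Qe'(4) 1(1) edge by (simp add: pairwise_def)
    next
      case 2
      then have "f x \<in> e" "f y \<in> e" "f x \<noteq> f y" using f(3) by (auto simp: bij_betw_def dest: inj_onD)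
      then show ?thesis using Qe'(5) 2(1) edge by (simp add: pairwise_def)
    next
      case 3
      then show ?thesis using f(4) edge by simp
    qed
  qed
  moreover have "f \<in> A \<union> B \<rightarrow>\<^sub>E verts G" using f(1) Qe'(1,2) by (auto simp: PiE_def Pi_def)
  ultimately show "f \<in> embeddings H G" using inj H by (auto simp: embeddings_def)
qed

text \<open>The pair is recovered from f as the images of A and B, so the union is disjoint.\<close>

lemma card_embeddings_eq_sum:
  assumes A: "finite A" "finite B" "card B = 2" "A \<inter> B = {}" "M \<subseteq> {{a, b} | a b. a \<in> A \<and> b \<in> B}"
    and H: "H = Graph (A \<union> B) ([A]\<^bsup>2\<^esup> \<union> [B]\<^bsup>2\<^esup> \<union> M)" and G: "finite (verts G)"
  shows "card (embeddings H G)
    = (\<Sum>p\<in>disjoint_pairs (adj G) (verts G) (card A). card (part_maps A B M (adj G) (fst p) (snd p)))"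
proof -
  let ?D = "disjoint_pairs (adj G) (verts G) (card A)"
  let ?F = "\<lambda>p. part_maps A B M (adj G) (fst p) (snd p)"
  have "embeddings H G = (\<Union>p\<in>?D. ?F p)"
    unfolding embeddings_eq_Union[OF A H] by (simp add: case_prod_beta)
  moreover have "card (\<Union>p\<in>?D. ?F p) = (\<Sum>p\<in>?D. card (?F p))"
  proof (rule card_UN_disjoint)
    show "finite ?D" using G by (rule finite_disjoint_pairs)
    show "\<forall>p\<in>?D. finite (?F p)"
      using A(1,2) by (auto simp: disjoint_pairs_def clq_iff intro: finite_part_maps)
    have "f ` A = fst p \<and> f ` B = snd p" if "f \<in> ?F p" for f p
      using that by (auto simp: part_maps_def bij_betw_def)
    then show "\<forall>p\<in>?D. \<forall>p'\<in>?D. p \<noteq> p' \<longrightarrow> ?F p \<inter> ?F p' = {}"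
      by (metis (no_types, lifting) disjoint_iff prod_eq_iff)
  qed
  ultimately show ?thesis by simp
qed

section \<open>Comparison with the Turan graph\<close>

text \<open>
  The number of embeddings carried by a pair that misses only the edges \<open>p\<close> and \<open>p'\<close>, with the two parts of \<open>H\<close>
  themselves serving as the pair.
\<close>

definition model_weight :: "'b set \<Rightarrow> 'b set \<Rightarrow> 'b set set \<Rightarrow> 'b \<times> 'b \<Rightarrow> 'b \<times> 'b \<Rightarrow> nat" where
  "model_weight A B M p p' = card (part_maps A B M (\<lambda>x y. (x, y) \<noteq> p \<and> (x, y) \<noteq> p') A B)"

lemma model_weight_mono:
  assumes "finite A" "finite B"
  shows "model_weight A B M p p' \<le> model_weight A B M p p"
  unfolding model_weight_def
  by (rule card_mono[OF finite_part_maps[OF assms assms]]) (auto simp: part_maps_def)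

lemma clq_turan_graph:
  assumes "W \<subseteq> {..<n}"
  shows "clq (adj (turan_graph r n)) W j = clq (turan_adj r) W j"
proof -
  have "adj (turan_graph r n) x y \<longleftrightarrow> turan_adj r x y" if "x \<in> W" "y \<in> W" for x y
    using that assms by (auto simp: adj_def turan_graph_def doubleton_eq_iff)
  then show ?thesis by (intro equalityI clq_mono) auto
qed

lemma disjoint_pairs_turan_graph:
  "disjoint_pairs (adj (turan_graph r n)) {..<n} s = disjoint_pairs (turan_adj r) {..<n} s"
  by (simp add: disjoint_pairs_def clq_turan_graph)

lemma star_pairs_turan_graph:
  "star_pairs (adj (turan_graph r n)) {..<n} s = star_pairs (turan_adj r) {..<n} s"
proof -
  have "missing_matching (adj (turan_graph r n)) Q e = missing_matching (turan_adj r) Q e"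
    if "(Q, e) \<in> disjoint_pairs (turan_adj r) {..<n} s" for Q e
  proof -
    have "Q \<subseteq> {..<n}" "e \<subseteq> {..<n}" using that by (auto simp: disjoint_pairs_def clq_iff)
    then have "adj (turan_graph r n) x y \<longleftrightarrow> turan_adj r x y" if "x \<in> Q" "y \<in> e" for x y
      using that by (auto simp: adj_def turan_graph_def doubleton_eq_iff)
    then show ?thesis by (simp add: missing_matching_def)
  qed
  then show ?thesis unfolding star_pairs_def disjoint_pairs_turan_graph by auto
qed

lemma simple_turan_graph: "simple_graph (turan_graph r n)"
  by (auto simp: simple_graph_def turan_graph_def)

lemma simple_graph_two_parts:
  assumes "finite A" "finite B" "A \<inter> B = {}" "M \<subseteq> {{a, b} | a b. a \<in> A \<and> b \<in> B}"
  shows "simple_graph (Graph (A \<union> B) ([A]\<^bsup>2\<^esup> \<union> [B]\<^bsup>2\<^esup> \<union> M))"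
proof -
  have "M \<subseteq> [A \<union> B]\<^bsup>2\<^esup>"
  proof
    fix x assume "x \<in> M"
    then obtain a b where "x = {a, b}" "a \<in> A" "b \<in> B" using assms(4) by blast
    then show "x \<in> [A \<union> B]\<^bsup>2\<^esup>" using assms(3) by auto
  qed
  then show ?thesis using assms(1,2) nsets_mono[of A "A \<union> B" 2] nsets_mono[of B "A \<union> B" 2]
    by (auto simp: simple_graph_def)
qed

lemma weighted_sum_star_pairs:
  assumes "finite V"
  shows "(\<Sum>p\<in>disjoint_pairs R V s. if missing_matching R (fst p) (snd p) then w else w')
    = w * (card (disjoint_pairs R V s) - card (star_pairs R V s)) + w' * card (star_pairs R V s)"
proof -
  let ?D = "disjoint_pairs R V s" and ?m = "\<lambda>p. missing_matching R (fst p) (snd p)"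
  have fin: "finite ?D" using assms by (rule finite_disjoint_pairs)
  have star: "star_pairs R V s = ?D \<inter> {p. \<not> ?m p}" by (auto simp: star_pairs_def)
  have "?D \<inter> {p. ?m p} = ?D - star_pairs R V s" by (auto simp: star)
  then have "card (?D \<inter> {p. ?m p}) = card ?D - card (star_pairs R V s)"
    using fin star by (metis card_Diff_subset finite_Int inf_le1)
  then show ?thesis
    using fin star by (simp add: sum.If_cases Collect_neg_eq)
qed

text \<open>With w' = w + d the expression equals w P + d S, which is monotone in P and in S
  although w (P - S) decreases in S.\<close>

lemma weighted_sum_le:
  fixes w w' :: nat
  assumes "w \<le> w'" "P \<le> P'" "S \<le> S'" "S \<le> P" "S' \<le> P'"
  shows "w * (P - S) + w' * S \<le> w * (P' - S') + w' * S'"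
proof -
  obtain d where d: "w' = w + d" using le_Suc_ex[OF assms(1)] by auto
  have eq: "w * (a - b) + w' * b = w * a + d * b" if ba: "b \<le> a" for a b
  proof -
    obtain c where "a = b + c" using le_Suc_ex[OF ba] by auto
    then show ?thesis by (simp add: d algebra_simps)
  qed
  show ?thesis
    unfolding eq[OF assms(4)] eq[OF assms(5)] using assms(2,3) by (intro add_mono mult_le_mono2)
qed

lemma card_star_pairs_le_disjoint_pairs:
  "finite V \<Longrightarrow> card (star_pairs R V s) \<le> card (disjoint_pairs R V s)"
  by (intro card_mono finite_disjoint_pairs) (auto simp: star_pairs_def)

lemma eventually_num_copies_le_turan:
  fixes k :: nat and H :: "'a ugraph" and A B :: "'a set" and M :: "'a set set"
  assumes k: "k = s + 2" "s > 0"
    and A: "finite A" "card A = s" and B: "finite B" "card B = 2" and AB: "A \<inter> B = {}"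
    and M: "M \<subseteq> {{a, b} | a b. a \<in> A \<and> b \<in> B}"
    and H: "H = Graph (A \<union> B) ([A]\<^bsup>2\<^esup> \<union> [B]\<^bsup>2\<^esup> \<union> M)"
  shows "\<forall>\<^sub>F n in sequentially. \<forall>G :: nat ugraph. simple_graph G \<and> card (verts G) = n \<and>
    graph_free (complete_graph k) G \<longrightarrow> num_copies H G \<le> num_copies H (turan_graph (k - 1) n)"
proof -
  let ?r = "Suc s"
  let ?D = "2 * s\<^sup>2 * (?r * 2 ^ ?r) + ?r * (?r * 2 ^ ?r) + 14 * ?r"
  have simpleH: "simple_graph H"
    unfolding H by (rule simple_graph_two_parts[OF A(1) B(1) AB M])
  obtain a0 where a0: "a0 \<in> A" using A k(2) by fastforce
  \<comment> \<open>For s = 1 the value a0 is a placeholder: a missing matching needs two vertices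
    of Q, so \<open>w2\<close> is then the weight of no pair and only \<open>w2 \<le> w1\<close>
    matters.\<close>
  obtain a1 where a1: "a1 \<in> A" "s \<ge> 2 \<Longrightarrow> a0 \<noteq> a1"
  proof (cases "s \<ge> 2")
    case True
    have "card (A - {a0}) = s - 1" using A a0 by simp
    then have "card (A - {a0}) \<noteq> 0" using True by simp
    then have "A - {a0} \<noteq> {}" by (metis card.empty)
    then show ?thesis using that by blast
  qed (use a0 that in auto)
  obtain b0 b1 where b: "B = {b0, b1}" "b0 \<noteq> b1" using B(2) by (auto simp: card_2_iff)
  define w1 where "w1 = model_weight A B M (a0, b0) (a0, b0)"
  define w2 where "w2 = model_weight A B M (a0, b0) (a1, b1)"
  have w: "w2 \<le> w1" unfolding w1_def w2_def by (rule model_weight_mono[OF A(1) B(1)])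
  have mm_card: "a0 \<noteq> a1" if mm: "missing_matching R Q e" and Q: "Q \<in> clq R V s"
    for R :: "nat \<Rightarrow> nat \<Rightarrow> bool" and V Q e
  proof -
    obtain q q' where "q \<in> Q" "q' \<in> Q" "q \<noteq> q'" using mm unfolding missing_matching_def by blast
    then have "2 \<le> s" using Q card_mono[of Q "{q, q'}"] by (auto simp: clq_iff)
    then show ?thesis using a1 by simp
  qed
  have main: "num_copies H G \<le> num_copies H (turan_graph ?r n)"
    if G: "simple_graph G" "card (verts G) = n" "graph_free (complete_graph k) G"
      and n: "n > 0" "?D * n ^ (s - 1) \<le> turan_cliques ?r s n" for G :: "nat ugraph" and n
  proof -
    let ?R = "adj G" and ?V = "verts G" and ?T = "turan_graph ?r n"
    have V: "finite ?V" "symp ?R" "irreflp ?R" "clq ?R ?V (Suc ?r) = {}"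
      using G graph_free_complete_iff[OF G(1), of k] k
      by (auto simp: simple_graph_def symp_adj irreflp_adj)
    have "card (embeddings H G) = (\<Sum>p\<in>disjoint_pairs ?R ?V s. card (part_maps A B M ?R (fst p) (snd p)))"
      using card_embeddings_eq_sum[OF A(1) B AB M H V(1)] A by simp
    also have "\<dots> \<le> (\<Sum>p\<in>disjoint_pairs ?R ?V s. if missing_matching ?R (fst p) (snd p) then w2 else w1)"
    proof (rule sum_mono)
      fix p assume p: "p \<in> disjoint_pairs ?R ?V s"
      obtain Q e where pq: "p = (Q, e)" by (cases p)
      have Q: "Q \<in> clq ?R ?V s" "e \<in> clq ?R (?V - Q) 2" using p pq by (auto simp: disjoint_pairs_def)
      then have Q': "finite Q" "finite e" "card Q = card A" "card e = card B" "Q \<inter> e = {}"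
        using A B by (auto simp: clq_iff)
      show "card (part_maps A B M ?R (fst p) (snd p)) \<le> (if missing_matching ?R (fst p) (snd p) then w2 else w1)"
      proof (cases "missing_matching ?R Q e")
        case True
        then obtain q q' u v where m: "q \<in> Q" "q' \<in> Q" "u \<in> e" "v \<in> e" "q \<noteq> q'" "u \<noteq> v" "\<not> ?R q u" "\<not> ?R q' v"
          by (auto simp: missing_matching_def)
        have "card (part_maps A B M ?R Q e) \<le> w2"
          unfolding w2_def model_weight_def
          by (rule card_part_maps_two_missing_le[where x = a0 and x' = a1 and y = b0 and y' = b1 and R = ?R,
                OF A(1) B(1) A(1) B(1) Q' m(1-4) a0 a1(1) _ _ _ _ m(7,8)])
            (use b m mm_card[OF True Q(1)] in auto)
        then show ?thesis using True pq by simp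
      next
        case False
        obtain q v where m: "q \<in> Q" "v \<in> e" "\<not> ?R q v"
          using disjoint_pairs_missing_edge[OF V(1,2,4)] p pq by blast
        have "card (part_maps A B M ?R Q e) \<le> w1"
          unfolding w1_def model_weight_def
          by (rule card_part_maps_two_missing_le[where x = a0 and x' = a0 and y = b0 and y' = b0 and R = ?R,
                OF A(1) B(1) A(1) B(1) Q' m(1,1,2,2) a0 a0 _ _ _ _ m(3,3)])
            (use b in auto)
        then show ?thesis using False pq by simp
      qed
    qed
    also have "\<dots> = w2 * (card (disjoint_pairs ?R ?V s) - card (star_pairs ?R ?V s)) + w1 * card (star_pairs ?R ?V s)"
      by (rule weighted_sum_star_pairs[OF V(1)])
    also have "\<dots> \<le> w2 * (card (disjoint_pairs (turan_adj ?r) {..<n} s) - card (star_pairs (turan_adj ?r) {..<n} s))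
        + w1 * card (star_pairs (turan_adj ?r) {..<n} s)"
    proof (rule weighted_sum_le[OF w])
      show "card (disjoint_pairs ?R ?V s) \<le> card (disjoint_pairs (turan_adj ?r) {..<n} s)"
        using disjoint_pairs_le_turan[OF V _ k(2)] G(2) n by simp
      have "card (star_pairs ?R ?V s) \<le> card (clq ?R ?V ?r) * ((n - ?r) * s)"
        using card_star_pairs_le[OF V k(2)] G(2) by simp
      also have "\<dots> \<le> turan_cliques ?r ?r n * ((n - ?r) * s)"
        using zykov[OF V, of ?r] G(2) by (intro mult_le_mono1) simp
      also have "\<dots> \<le> card (star_pairs (turan_adj ?r) {..<n} s)"
        by (rule card_star_pairs_turan)
      finally show "card (star_pairs ?R ?V s) \<le> card (star_pairs (turan_adj ?r) {..<n} s)" .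
    qed (use V(1) in \<open>auto intro: card_star_pairs_le_disjoint_pairs\<close>)
    also have "\<dots> = (\<Sum>p\<in>disjoint_pairs (adj ?T) {..<n} s. if missing_matching (adj ?T) (fst p) (snd p) then w2 else w1)"
      by (subst weighted_sum_star_pairs) (simp_all add: star_pairs_turan_graph disjoint_pairs_turan_graph)
    also have "\<dots> \<le> (\<Sum>p\<in>disjoint_pairs (adj ?T) {..<n} s. card (part_maps A B M (adj ?T) (fst p) (snd p)))"
    proof (rule sum_mono)
      fix p assume p: "p \<in> disjoint_pairs (adj ?T) {..<n} s"
      obtain Q e where pq: "p = (Q, e)" by (cases p)
      have D: "(Q, e) \<in> disjoint_pairs (turan_adj ?r) {..<n} s"
        using p pq disjoint_pairs_turan_graph by simp
      then have Q: "Q \<in> clq (turan_adj ?r) {..<n} s" "e \<in> clq (turan_adj ?r) ({..<n} - Q) 2"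
        by (auto simp: disjoint_pairs_def)
      then have Q': "finite Q" "finite e" "card A = card Q" "card B = card e" "Q \<subseteq> {..<n}" "e \<subseteq> {..<n}"
        using A B by (auto simp: clq_iff)
      have adjT: "adj ?T x y \<longleftrightarrow> turan_adj ?r x y" if "x \<in> Q" "y \<in> e" for x y
        using that Q' by (auto simp: adj_def turan_graph_def doubleton_eq_iff)
      have injQ: "x = y" if "x \<in> Q" "y \<in> Q" "x mod ?r = y mod ?r" for x y
        using turan_clique_inj[OF Q(1)] that by (auto dest: inj_onD)
      have inje: "x = y" if "x \<in> e" "y \<in> e" "x mod ?r = y mod ?r" for x y
        using turan_clique_inj[OF Q(2)] that by (auto dest: inj_onD)
      show "(if missing_matching (adj ?T) (fst p) (snd p) then w2 else w1) \<le> card (part_maps A B M (adj ?T) (fst p) (snd p))"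
      proof (cases "missing_matching (adj ?T) Q e")
        case True
        then obtain q q' u v where m: "q \<in> Q" "q' \<in> Q" "u \<in> e" "v \<in> e" "q \<noteq> q'" "u \<noteq> v"
          and miss: "\<not> adj ?T q u" "\<not> adj ?T q' v"
          by (auto simp: missing_matching_def)
        have mm: "q mod ?r = u mod ?r" "q' mod ?r = v mod ?r" using miss adjT m by auto
        have "e = {u, v}"
          using m(3,4,6) Q'(2,4) B by (intro card_subset_eq[symmetric]) auto
        \<comment> \<open>Residues are distinct within Q and within e, so each end of the edge has
          at most one non-neighbour in Q; q and q' are these for u and v.\<close>
        have only: "x = q \<and> y = u \<or> x = q' \<and> y = v" if "x \<in> Q" "y \<in> e" "\<not> adj ?T x y" for x y
        proof -
          have "x mod ?r = y mod ?r" using that adjT by auto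
          then show ?thesis using mm m that injQ \<open>e = {u, v}\<close> by (metis insertE singletonD)
        qed
        have "a0 \<noteq> a1" using mm_card[OF True, of "{..<n}"] Q(1) clq_turan_graph[of "{..<n}" n ?r s] by simp
        have "w2 \<le> card (part_maps A B M (adj ?T) Q e)"
          unfolding w2_def model_weight_def
          by (rule card_part_maps_two_missing_le[where v = b0 and v' = b1,
                OF A(1) B(1) Q'(1,2) A(1) B(1) Q'(3,4) AB a0 a1(1) _ _ m(1-4) _ _ _ _ only])
            (use b m \<open>a0 \<noteq> a1\<close> in auto)
        then show ?thesis using True pq by simp
      next
        case False
        obtain q v where m: "q \<in> Q" "v \<in> e" "\<not> turan_adj ?r q v"
          using disjoint_pairs_missing_edge[OF _ symp_turan turan_clique_free D] by auto
        \<comment> \<open>Without a missing matching a second missing edge would share a vertex with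
          the first; equal residues then force the other ends to agree too.\<close>
        have only: "x = q \<and> y = v" if xy: "x \<in> Q" "y \<in> e" "\<not> adj ?T x y" for x y
        proof -
          have 1: "x mod ?r = y mod ?r" using xy adjT by auto
          have 2: "\<not> adj ?T q v" using m adjT by auto
          have "x = q \<or> y = v" using False xy m(1,2) 2 by (auto simp: missing_matching_def)
          then show ?thesis using 1 m injQ[OF xy(1) m(1)] inje[OF xy(2) m(2)] by auto
        qed
        have "w1 \<le> card (part_maps A B M (adj ?T) Q e)"
          unfolding w1_def model_weight_def
          by (rule card_part_maps_two_missing_le[where v = b0 and v' = b0,
                OF A(1) B(1) Q'(1,2) A(1) B(1) Q'(3,4) AB a0 a0 _ _ m(1,1,2,2) _ _ _ _ disjI1[OF only]])
            (use b in auto)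
        then show ?thesis using False pq by simp
      qed
    qed
    also have "\<dots> = card (embeddings H ?T)"
      using card_embeddings_eq_sum[OF A(1) B AB M H, of ?T] A by (simp add: turan_graph_def)
    finally show ?thesis by (rule num_copies_le[OF simpleH G(1) simple_turan_graph])
  qed
  have "\<forall>\<^sub>F n in sequentially. ?D * n ^ (s - 1) \<le> turan_cliques ?r s n"
    using k(2) by (intro turan_cliques_eventually_large) auto
  then show ?thesis
    using eventually_gt_at_top[of 0]
  proof eventually_elim
    case (elim n)
    then show ?case using main k(1) by auto
  qed
qed

theorem proposition2p6:
  fixes k :: nat and H :: "'a ugraph" and A B :: "'a set" and M :: "'a set set"
  assumes "k \<ge> 3"
    and "finite A" and "card A = k - 2"
    and "finite B" and "card B = 2"
    and "A \<inter> B = {}"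
    and "M \<subseteq> {{a, b} | a b. a \<in> A \<and> b \<in> B}"
    and "H = Graph (A \<union> B) ([A]\<^bsup>2\<^esup> \<union> [B]\<^bsup>2\<^esup> \<union> M)"
    and "\<not> graph_iso H (complete_graph k)"
  shows "turan_good k H"
proof -
  have simpleH: "simple_graph H"
    unfolding assms(8) by (rule simple_graph_two_parts[OF assms(2,4,6,7)])
  have cAB: "card (A \<union> B) = k" "finite (A \<union> B)" using assms by (auto simp: card_Un_disjoint)
  have "clq (adj H) (verts H) k = {}"
  proof (rule ccontr)
    assume "clq (adj H) (verts H) k \<noteq> {}"
    then obtain Q where Q: "Q \<in> clq (adj H) (verts H) k" by blast
    \<comment> \<open>H has exactly k vertices, so a k-clique uses all of them and H would be
      complete, which the hypothesis excludes.\<close>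
    then have "Q = A \<union> B"
      using cAB assms(8) by (intro card_subset_eq) (auto simp: clq_iff)
    then have "[A \<union> B]\<^bsup>2\<^esup> \<subseteq> edges H"
      using Q by (auto simp: clq_iff pairwise_def adj_def elim!: nsets2_E)
    then have E: "edges H = [verts H]\<^bsup>2\<^esup>" using simpleH assms(8) by (auto simp: simple_graph_def)
    obtain h where h: "bij_betw h (verts H) {..<k}"
      using finite_same_card_bij[of "verts H" "{..<k}"] cAB assms(8) by auto
    have "(`) h ` edges H = [{..<k}]\<^bsup>2\<^esup>"
      unfolding E using bij_betw_nsets[OF h, of 2] by (simp add: bij_betw_def)
    then have "graph_iso H (complete_graph k)"
      using h by (auto simp: graph_iso_def complete_graph_def)
    then show False using assms(9) by simp
  qed
  then have free: "graph_free (complete_graph k) H"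
    using graph_free_complete_iff[OF simpleH] by simp
  have "\<forall>\<^sub>F n in sequentially. \<forall>G :: nat ugraph. simple_graph G \<and> card (verts G) = n \<and>
    graph_free (complete_graph k) G \<longrightarrow> num_copies H G \<le> num_copies H (turan_graph (k - 1) n)"
    by (rule eventually_num_copies_le_turan[of k "k - 2", OF _ _ assms(2-8)]) (use assms(1) in auto)
  then have "\<forall>\<^sub>F n in sequentially. gen_turan n H (complete_graph k) = num_copies H (turan_graph (k - 1) n)"
  proof eventually_elim
    case (elim n)
    let ?T = "turan_graph (k - 1) n"
    have T: "verts ?T = {..<n}" by (simp add: turan_graph_def)
    have "clq (adj ?T) (verts ?T) k = {}"
      unfolding T clq_turan_graph[OF order_refl]
      using turan_clique_free[of "k - 1" "{..<n}"] assms(1) by simp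
    then have "graph_free (complete_graph k) ?T"
      by (simp add: graph_free_complete_iff[OF simple_turan_graph])
    then have "num_copies H ?T \<in> gen_turan_values n H (complete_graph k)"
      unfolding gen_turan_values_def using simple_turan_graph T by (intro CollectI exI[of _ ?T]) simp
    then show ?case
      unfolding gen_turan_def using elim finite_gen_turan_values
      by (intro Max_eqI) (auto simp: gen_turan_values_def)
  qed
  then show ?thesis using free by (simp add: turan_good_def)
qed

end
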